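(* Let $K\geq2$, $P>0$ and $\sigma_1^2\geq\sigma_2^2\geq\cdots\geq\sigma_K^2>0$, and for $k\in\{1,\ldots,K\}$ let $N_k=\left(\sum_{k'=1}^{k}\frac{1}{\sigma_{k'}^2}\right)^{-1}$. Then \[ C^{(\mathrm{Lin})}\leq \frac12\log\left(1+\frac{\alpha_1^\star P}{(1-\alpha_1^\star)P+\sigma_1^2}\right), \] where $\alpha_1^\star$ lies in the open interval $(0,1)$ and is such that there exist $\alpha_2^\star,\ldots,\alpha_K^\star\in(0,1)$ with $\alpha_1^\star+\alpha_2^\star+\cdots+\alpha_K^\star=1$ and, for every $k\in\{2,\ldots,K\}$, \[ \frac12\log\left(1+\frac{\alpha_k^\star P}{(1-\alpha_1^\star-\cdots-\alpha_k^\star)P+N_k}\right)=\frac12\log\left(1+\frac{\alpha_1^\star P}{(1-\alpha_1^\star)P+\sigma_1^2}\right). \]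
   Context: Channel: for blocklength $n$, at time $i$ the transmitter sends $X_i\in\mathbb{R}$ and Receiver $k\in\{1,\ldots,K\}$ observes $Y_{k,i}=X_i+Z_{k,i}$, where the vectors $(Z_{1,i},\ldots,Z_{K,i})$ are i.i.d. over $i$, centered Gaussian with covariance $\mathrm{diag}(\sigma_1^2,\ldots,\sigma_K^2)$. A common message $M$ uniform on $\{1,\ldots,\lfloor e^{nR}\rfloor\}$, independent of the noises, is to be decoded by all receivers. Perfect feedback: inputs $X_i=f_i(M,Y_1^{i-1},\ldots,Y_K^{i-1})$, subject to $\frac1n\mathbb{E}[\sum_{i=1}^nX_i^2]\leq P$. Receiver $k$ decodes $\hat M^{(k)}=g_k(Y_k^n)$; error probability $P_e^{(n)}=\Pr[\bigcup_k\{\hat M^{(k)}\neq M\}]$. Logarithms are natural. A linear-feedback scheme with a message point: the encoder maps $M$ by an arbitrary function to a real number $\Theta$, and each $X_i$ is a linear function of $(\Theta,Y_1^{i-1},\ldots,Y_K^{i-1})$; decoders are arbitrary. A rate $R>0$ is achievable by such schemes if for every $\epsilon>0$ there is a sequence (over $n$) of such schemes satisfying the power constraint with $P_e^{(n)}<\epsilon$ for all sufficiently large $n$; $C^{(\mathrm{Lin})}$ denotes the supremum of such rates. *)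

theory Defs
  imports "HOL-Probability.Probability"
begin

text \<open>Receivers are indexed by k in {1..K}, time by i in {0..<n}.
  Noise variances sig2 k = sigma_k^2.  The noise of block length n is the
  product measure of independent centered Gaussians Z(k,i) with variance sig2 k.\<close>

definition noise_space :: "nat \<Rightarrow> (nat \<Rightarrow> real) \<Rightarrow> nat \<Rightarrow> (nat \<times> nat \<Rightarrow> real) measure" where
  "noise_space K sig2 n =
     PiM ({1..K} \<times> {..<n}) (\<lambda>(k,i). density lborel (normal_density 0 (sqrt (sig2 k))))"

text \<open>Linear-feedback encoder with message point theta:
  X_i = a i * theta + sum over k in {1..K}, j < i of b i k j * Y_{k,j},
  where Y_{k,j} = X_j + Z(k,j).  The list contains X_0, ..., X_{i-1}.\<close>

fun lin_inputs_list ::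
  "nat \<Rightarrow> (nat \<Rightarrow> real) \<Rightarrow> (nat \<Rightarrow> nat \<Rightarrow> nat \<Rightarrow> real) \<Rightarrow> real \<Rightarrow> (nat \<times> nat \<Rightarrow> real) \<Rightarrow> nat \<Rightarrow> real list" where
  "lin_inputs_list K a b \<theta> z 0 = []"
| "lin_inputs_list K a b \<theta> z (Suc i) =
     (let xs = lin_inputs_list K a b \<theta> z i
      in xs @ [a i * \<theta> + (\<Sum>k\<in>{1..K}. \<Sum>j<i. b i k j * (xs ! j + z (k, j)))])"

definition lin_X ::
  "nat \<Rightarrow> (nat \<Rightarrow> real) \<Rightarrow> (nat \<Rightarrow> nat \<Rightarrow> nat \<Rightarrow> real) \<Rightarrow> real \<Rightarrow> (nat \<times> nat \<Rightarrow> real) \<Rightarrow> nat \<Rightarrow> real" where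
  "lin_X K a b \<theta> z i = lin_inputs_list K a b \<theta> z (Suc i) ! i"

definition lin_Y ::
  "nat \<Rightarrow> (nat \<Rightarrow> real) \<Rightarrow> (nat \<Rightarrow> nat \<Rightarrow> nat \<Rightarrow> real) \<Rightarrow> real \<Rightarrow> (nat \<times> nat \<Rightarrow> real) \<Rightarrow> nat \<Rightarrow> nat \<Rightarrow> real" where
  "lin_Y K a b \<theta> z k i = lin_X K a b \<theta> z i + z (k, i)"

definition num_msgs :: "nat \<Rightarrow> real \<Rightarrow> nat" where
  "num_msgs n R = nat \<lfloor>exp (real n * R)\<rfloor>"

text \<open>Average power (1/n) E[sum_i X_i^2], M uniform on {1..L}, independent of the noise.\<close>
definition lin_power ::
  "nat \<Rightarrow> (nat \<Rightarrow> real) \<Rightarrow> nat \<Rightarrow> nat \<Rightarrow> (nat \<Rightarrow> real) \<Rightarrow> (nat \<Rightarrow> nat \<Rightarrow> nat \<Rightarrow> real) \<Rightarrow> (nat \<Rightarrow> real) \<Rightarrow> ennreal" where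
  "lin_power K sig2 n L a b \<theta> =
     ennreal (1 / (real n * real L)) *
     (\<Sum>m\<in>{1..L}. \<integral>\<^sup>+ z. ennreal (\<Sum>i<n. (lin_X K a b (\<theta> m) z i)\<^sup>2) \<partial>noise_space K sig2 n)"

definition lin_error ::
  "nat \<Rightarrow> (nat \<Rightarrow> real) \<Rightarrow> nat \<Rightarrow> nat \<Rightarrow> (nat \<Rightarrow> real) \<Rightarrow> (nat \<Rightarrow> nat \<Rightarrow> nat \<Rightarrow> real) \<Rightarrow> (nat \<Rightarrow> real)
     \<Rightarrow> (nat \<Rightarrow> (nat \<Rightarrow> real) \<Rightarrow> nat) \<Rightarrow> real" where
  "lin_error K sig2 n L a b \<theta> g =
     (1 / real L) *
     (\<Sum>m\<in>{1..L}. measure (noise_space K sig2 n)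
        {z \<in> space (noise_space K sig2 n).
           \<exists>k\<in>{1..K}. g k (restrict (\<lambda>i. lin_Y K a b (\<theta> m) z k i) {..<n}) \<noteq> m})"

definition lin_scheme_ok ::
  "nat \<Rightarrow> real \<Rightarrow> (nat \<Rightarrow> real) \<Rightarrow> nat \<Rightarrow> nat \<Rightarrow> real \<Rightarrow> bool" where
  "lin_scheme_ok K P sig2 n L \<epsilon> \<longleftrightarrow>
     (\<exists>(\<theta>::nat \<Rightarrow> real) (a::nat \<Rightarrow> real) (b::nat \<Rightarrow> nat \<Rightarrow> nat \<Rightarrow> real)
        (g::nat \<Rightarrow> (nat \<Rightarrow> real) \<Rightarrow> nat).
        (\<forall>k\<in>{1..K}. g k \<in> measurable (PiM {..<n} (\<lambda>_. borel)) (count_space UNIV)) \<and>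
        lin_power K sig2 n L a b \<theta> \<le> ennreal P \<and>
        lin_error K sig2 n L a b \<theta> g < \<epsilon>)"

definition lin_achievable :: "nat \<Rightarrow> real \<Rightarrow> (nat \<Rightarrow> real) \<Rightarrow> real \<Rightarrow> bool" where
  "lin_achievable K P sig2 R \<longleftrightarrow>
     R > 0 \<and> (\<forall>\<epsilon>>0. \<exists>n0. \<forall>n\<ge>n0. lin_scheme_ok K P sig2 n (num_msgs n R) \<epsilon>)"

definition lin_capacity :: "nat \<Rightarrow> real \<Rightarrow> (nat \<Rightarrow> real) \<Rightarrow> ereal" where
  "lin_capacity K P sig2 = Sup {ereal R | R. lin_achievable K P sig2 R}"

definition N_eff :: "(nat \<Rightarrow> real) \<Rightarrow> nat \<Rightarrow> real" where
  "N_eff sig2 k = inverse (\<Sum>k'\<in>{1..k}. inverse (sig2 k'))"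

end

theory Submission
  imports Defs "HOL-Library.Poly_Mapping" "HOL-Real_Asymp.Real_Asymp"
begin

text \<open>Decoding turns into geometry.  If receiver \<open>k\<close> decodes \<open>L\<close> messages reliably, then any shift of
  the noise that imitates a unit change of the message point costs an energy of order
  \<open>(L / A)\<^sup>2\<close>, where \<open>A\<close> bounds most message points: otherwise many decision regions, which
  are disjoint, would have large probability under nearly equal Gaussian measures.  By duality some linear
  combination of the outputs of receiver \<open>k\<close> has message coefficient 1 and noise of size at most
  \<open>16 A / L\<close>.  Normalising at one time slot and splitting the noise of that slot into two independent
  halves, one half becomes a private Gaussian message that the receiver recovers with an error which is
  exponentially small in the rate.

  For \<open>K\<close> such private messages let receiver \<open>k\<close> also see the outputs of the receivers before it.  The
  combined noise then has variance \<open>N\<^sub>k\<close>, and symmetry of the Gram determinant expresses the gain of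
  receiver \<open>k\<close> as a product over time of ratios
  \<open>(a\<^sub>k\<^sub>-\<^sub>1 + N\<^sub>k) / (a\<^sub>k + N\<^sub>k)\<close> of residual input powers, where
  \<open>a\<^sub>0\<close> is the input power.  A weighted sum of the logarithms, with multipliers for which the water levels
  \<open>P (1 - \<alpha>\<^sub>1 - \<dots> - \<alpha>\<^sub>k)\<close> are stationary, is at most its value at those levels.\<close>

section \<open>Power levels\<close>

text \<open>Index \<open>i\<close> counts down from the last receiver: this is the level
  \<open>p (K - i)\<close> forced by \<open>p K = 0\<close> and
  \<open>p (k - 1) + N k = \<rho> * (p k + N k)\<close>.\<close>

primrec backward_level :: "(nat \<Rightarrow> real) \<Rightarrow> nat \<Rightarrow> real \<Rightarrow> nat \<Rightarrow> real" where
  "backward_level N K \<rho> 0 = 0"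
| "backward_level N K \<rho> (Suc i) = \<rho> * backward_level N K \<rho> i + (\<rho> - 1) * N (K - i)"

lemma continuous_on_backward_level: "continuous_on S (\<lambda>\<rho>. backward_level N K \<rho> i)"
  by (induction i) (auto intro!: continuous_intros)

lemma backward_level_one: "backward_level N K 1 i = 0"
  by (induction i) auto

lemma backward_level_nonneg:
  assumes "\<And>k. k \<in> {1..K} \<Longrightarrow> N k > 0" "\<rho> \<ge> 1" "i \<le> K"
  shows "backward_level N K \<rho> i \<ge> 0"
  using assms(3)
proof (induction i)
  case (Suc i)
  have "N (K - i) > 0" using Suc.prems by (intro assms(1)) auto
  then show ?case using Suc assms(2) by simp
qed simp

text \<open>The first backward step already contributes this amount, and for
  \<open>\<rho> \<ge> 1\<close> later steps never lower the level. This feeds the upper endpoint of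
  an intermediate value argument.\<close>

lemma backward_level_lower:
  assumes "\<And>k. k \<in> {1..K} \<Longrightarrow> N k > 0" "\<rho> \<ge> 1" "i < K"
  shows "backward_level N K \<rho> (Suc i) \<ge> (\<rho> - 1) * N K"
  using assms(3)
proof (induction i)
  case 0
  then show ?case by simp
next
  case (Suc i)
  have "N (K - Suc i) > 0" using Suc.prems by (intro assms(1)) auto
  moreover have "1 * backward_level N K \<rho> (Suc i) \<le> \<rho> * backward_level N K \<rho> (Suc i)"
    using Suc.prems assms by (intro mult_right_mono backward_level_nonneg) auto
  moreover have "backward_level N K \<rho> (Suc i) \<ge> (\<rho> - 1) * N K"
    using Suc by simp
  ultimately have "0 \<le> (\<rho> - 1) * N (K - Suc i)"
    "(\<rho> - 1) * N K \<le> \<rho> * backward_level N K \<rho> (Suc i)"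
    using assms(2) by auto
  then show ?case by (subst backward_level.simps(2)) linarith
qed

text \<open>A shooting argument: \<open>p K = 0\<close> makes every level a continuous function of
  \<open>\<rho>\<close>, and \<open>\<rho>\<close> is tuned until the top level equals
  \<open>P\<close>.\<close>

lemma exists_power_levels:
  fixes N :: "nat \<Rightarrow> real"
  assumes N: "\<And>k. k \<in> {1..K} \<Longrightarrow> N k > 0" and "K \<ge> 1" "(P::real) > 0"
  obtains \<rho> p where "\<rho> > 1" "p 0 = P" "p K = 0"
    "\<And>k. k \<in> {1..K} \<Longrightarrow> p (k - 1) + N k = \<rho> * (p k + N k)"
proof -
  have NK: "N K > 0" using assms(2) by (intro N) auto
  \<comment> \<open>Chosen so that \<open>(?r - 1) * N K = P\<close>; by
    \<open>backward_level_lower\<close> the top level is then at least \<open>P\<close>.\<close>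
  let ?r = "1 + P / N K"
  have "\<exists>\<rho>. 1 \<le> \<rho> \<and> \<rho> \<le> ?r \<and> backward_level N K \<rho> K = P"
  proof (rule IVT')
    show "backward_level N K 1 K \<le> P" using assms by (simp add: backward_level_one)
    have "(?r - 1) * N K \<le> backward_level N K ?r (Suc (K - 1))"
      by (rule backward_level_lower[OF N]) (use NK assms(2,3) in auto)
    then show "P \<le> backward_level N K ?r K" using NK assms(2,3) by simp
    show "1 \<le> ?r" using NK assms(3) by simp
  qed (rule continuous_on_backward_level)
  then obtain \<rho> where r: "\<rho> \<ge> 1" "backward_level N K \<rho> K = P" by blast
  have "\<rho> \<noteq> 1" using r assms by (auto simp: backward_level_one)
  moreover have "backward_level N K \<rho> (K - (k - 1)) + N k = \<rho> * (backward_level N K \<rho> (K - k) + N k)"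
    if "k \<in> {1..K}" for k
  proof -
    have e: "K - (k - 1) = Suc (K - k)" using that by auto
    show ?thesis unfolding e using that by (simp add: algebra_simps)
  qed
  ultimately show ?thesis using r
    by (intro that[of \<rho> "\<lambda>k. backward_level N K \<rho> (K - k)"]) auto
qed

lemma power_levels_nonneg:
  fixes p N :: "nat \<Rightarrow> real"
  assumes N: "\<And>k. k \<in> {1..K} \<Longrightarrow> N k > 0" and "\<rho> \<ge> 1" "p K = 0"
    and step: "\<And>k. k \<in> {1..K} \<Longrightarrow> p (k - 1) + N k = \<rho> * (p k + N k)"
    and "k \<le> K"
  shows "p k \<ge> 0"
  using \<open>k \<le> K\<close>
proof (induction rule: inc_induct)
  case (step k)
  have "N (Suc k) > 0" using step by (intro N) auto
  moreover have "p k + N (Suc k) = \<rho> * (p (Suc k) + N (Suc k))"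
    using assms(4)[of "Suc k"] step by auto
  moreover have "1 * (p (Suc k) + N (Suc k)) \<le> \<rho> * (p (Suc k) + N (Suc k))"
    using step calculation assms(2) by (intro mult_right_mono) auto
  ultimately have "p (Suc k) + N (Suc k) \<le> p k + N (Suc k)" by simp
  then show ?case using step by simp
qed (simp add: assms)

lemma power_levels_decreasing:
  fixes p N :: "nat \<Rightarrow> real"
  assumes N: "\<And>k. k \<in> {1..K} \<Longrightarrow> N k > 0" and "\<rho> > 1" "p K = 0"
    and step: "\<And>k. k \<in> {1..K} \<Longrightarrow> p (k - 1) + N k = \<rho> * (p k + N k)"
    and "k \<in> {1..K}"
  shows "p k < p (k - 1)"
proof -
  have "p k \<ge> 0" using power_levels_nonneg[of K N \<rho> p k] assms by auto
  then have "1 * (p k + N k) < \<rho> * (p k + N k)"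
    using N[OF assms(5)] assms(2) by (intro mult_strict_right_mono) auto
  then have "p k + N k < p (k - 1) + N k" using step[OF assms(5)] by simp
  then show ?thesis by simp
qed

text \<open>With weight \<open>t = (p + M) / (p + N)\<close>, the ratio
  \<open>(a + N) / (p + N)\<close> is the convex combination of \<open>(a + M) / (p + M)\<close> and
  1. Concavity of \<open>ln\<close> and \<open>ln 1 = 0\<close> give the claim.\<close>

lemma ln_shift_ratio:
  fixes a p M N :: real
  assumes "a \<ge> 0" "p \<ge> 0" "0 < M" "M \<le> N"
  shows "(p + M) / (p + N) * ln ((a + M) / (p + M)) \<le> ln ((a + N) / (p + N))"
proof -
  define t where "t = (p + M) / (p + N)"
  have t: "0 < t" "t \<le> 1" using assms by (auto simp: t_def)
  have pos: "(a + M) / (p + M) > 0" using assms by auto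
  have "t * ln ((a + M) / (p + M)) + (1 - t) * ln 1 \<le> ln (t * ((a + M) / (p + M)) + (1 - t) * 1)"
    using concave_onD[OF ln_concave, of "1 - t" "(a + M) / (p + M)" 1] t pos by simp
  also have "t * ((a + M) / (p + M)) + (1 - t) * 1 = (a + N) / (p + N)"
    using assms by (simp add: t_def divide_simps)
  finally show ?thesis by (simp add: t_def)
qed

text \<open>The multipliers make every unknown level stationary at its extremal value; the
  coefficient of each level is then controlled by Jensen's inequality.\<close>

lemma sum_ln_ratio_bound:
  fixes p N :: "nat \<Rightarrow> real"
  assumes "K \<ge> 1" and N: "\<And>k. k \<in> {1..K} \<Longrightarrow> N k > 0"
    and N_mono: "\<And>k. k \<in> {1..<K} \<Longrightarrow> N (Suc k) \<le> N k"
    and p: "\<And>k. k \<le> K \<Longrightarrow> p k \<ge> 0" "p K = 0"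
    and step: "\<And>k. k \<in> {1..K} \<Longrightarrow> p (k - 1) + N k = \<rho> * (p k + N k)"
  obtains lam :: "nat \<Rightarrow> real" and mu :: real where "\<And>k. k \<in> {1..K} \<Longrightarrow> lam k > 0" "mu \<ge> 0"
    "\<And>a. (\<And>k. k \<le> K \<Longrightarrow> a k \<ge> 0) \<Longrightarrow>
       (\<Sum>k\<in>{1..K}. lam k * ln ((a (k - 1) + N k) / (a k + N k)))
         \<le> (\<Sum>k\<in>{1..K}. lam k) * ln \<rho> + mu * (a 0 - p 0)"
proof -
  \<comment> \<open>This recursion keeps \<open>lam (Suc k) / (p k + N (Suc k))\<close> equal to
    \<open>lam k / (p k + N k)\<close>, which is stationarity in \<open>a k\<close> at
    \<open>p k\<close>. Since \<open>lam 1 = 1\<close>, \<open>mu\<close> is the slope in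
    \<open>a 0\<close> at \<open>p 0\<close>.\<close>
  define lam where "lam k = (\<Prod>l\<in>{1..<k}. (p l + N (Suc l)) / (p l + N l))" for k
  define mu where "mu = 1 / (p 0 + N 1)"
  have pos: "lam k > 0" if "k \<in> {1..K}" for k
    unfolding lam_def using that by (intro prod_pos) (auto intro!: divide_pos_pos add_nonneg_pos p N)
  have mu: "mu \<ge> 0" unfolding mu_def using p(1)[of 0] N[of 1] assms(1) by auto
  have main: "(\<Sum>k\<in>{1..j}. lam k * ln ((a (k - 1) + N k) / (a k + N k)))
      \<le> (\<Sum>k\<in>{1..j}. lam k) * ln \<rho> + mu * (a 0 - p 0) - lam j * ln ((a j + N j) / (p j + N j))"
    if "1 \<le> j" "j \<le> K" and a: "\<And>k. k \<le> K \<Longrightarrow> a k \<ge> 0" for j a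
    using that(1,2)
  proof (induction j rule: dec_induct)
    have split: "ln ((a (k - 1) + N k) / (a k + N k)) =
        ln ((a (k - 1) + N k) / (p (k - 1) + N k)) + ln \<rho> - ln ((a k + N k) / (p k + N k))"
      if "k \<in> {1..K}" for k
    proof -
      have "k - 1 \<le> K" using that by auto
      then have q: "a (k - 1) + N k > 0" "p (k - 1) + N k > 0" "a k + N k > 0" "p k + N k > 0"
        using that by (auto intro!: add_nonneg_pos p N a)
      then have "\<rho> = (p (k - 1) + N k) / (p k + N k)" using step[OF that] by (simp add: field_simps)
      then show ?thesis using q by (simp add: ln_div)
    qed
    {
      case base
      have q: "a 0 + N 1 > 0" "p 0 + N 1 > 0"
        using assms(1) by (auto intro!: add_nonneg_pos p N a)
      have "ln ((a 0 + N 1) / (p 0 + N 1)) \<le> (a 0 + N 1) / (p 0 + N 1) - 1"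
        using q by (intro ln_le_minus_one) auto
      also have "\<dots> = mu * (a 0 - p 0)" using q by (simp add: mu_def field_simps)
      finally show ?case using split[of 1] assms(1) by (simp add: lam_def)
    next
      case (step j)
      have "Suc j \<in> {1..K}" using step by auto
      then have "N (Suc j) > 0" by (rule N)
      then have J: "(p j + N (Suc j)) / (p j + N j) * ln ((a j + N (Suc j)) / (p j + N (Suc j)))
          \<le> ln ((a j + N j) / (p j + N j))"
        using step by (intro ln_shift_ratio a p N_mono) auto
      have lam_Suc: "lam (Suc j) = lam j * ((p j + N (Suc j)) / (p j + N j))"
        using step by (simp add: lam_def prod.atLeastLessThan_Suc)
      have "lam (Suc j) * ln ((a j + N (Suc j)) / (p j + N (Suc j)))
          \<le> lam j * ln ((a j + N j) / (p j + N j))"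
        using mult_left_mono[OF J, of "lam j"] pos[of j] step by (simp add: lam_Suc mult.assoc)
      moreover have "lam (Suc j) * ln ((a (Suc j - 1) + N (Suc j)) / (a (Suc j) + N (Suc j))) =
          lam (Suc j) * ln ((a j + N (Suc j)) / (p j + N (Suc j))) + lam (Suc j) * ln \<rho>
          - lam (Suc j) * ln ((a (Suc j) + N (Suc j)) / (p (Suc j) + N (Suc j)))"
        by (subst split[OF \<open>Suc j \<in> {1..K}\<close>]) (simp add: algebra_simps)
      moreover have "(\<Sum>k\<in>{1..Suc j}. f k) = (\<Sum>k\<in>{1..j}. f k) + f (Suc j)" for f :: "nat \<Rightarrow> real"
        using step by simp
      ultimately show ?case using step.IH step.prems by (simp only: distrib_right) linarith
    }
  qed
  show ?thesis
  proof (rule that[of lam mu, OF pos mu])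
    fix a :: "nat \<Rightarrow> real" assume a: "\<And>k. k \<le> K \<Longrightarrow> a k \<ge> 0"
    have "N K > 0" "lam K > 0" "a K \<ge> 0" using assms(1) N pos a by auto
    then have "lam K * ln ((a K + N K) / (p K + N K)) \<ge> 0" using p(2) by simp
    then show "(\<Sum>k\<in>{1..K}. lam k * ln ((a (k - 1) + N k) / (a k + N k)))
         \<le> (\<Sum>k\<in>{1..K}. lam k) * ln \<rho> + mu * (a 0 - p 0)"
      using main[OF assms(1) order_refl, of a] a by simp
  qed
qed

section \<open>Squared distance to a span\<close>

text \<open>In a space of centered Gaussian variables with covariance as inner product, this is the
  conditional variance of \<open>v\<close> given \<open>S\<close>. The infimum form makes sense even
  where no projection is known.\<close>

definition sqdist :: "'a::real_inner \<Rightarrow> 'a set \<Rightarrow> real" where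
  "sqdist v S = (infdist v (span S))\<^sup>2"

lemma inner_span_eq_0:
  fixes v :: "'a::real_inner"
  assumes "a \<in> span S" "\<And>s. s \<in> S \<Longrightarrow> v \<bullet> s = 0"
  shows "v \<bullet> a = 0"
  using orthogonal_to_span[of a S v] assms by (auto simp: orthogonal_def)

text \<open>By Pythagoras, no other point of the span is closer to \<open>v\<close> than
  \<open>p\<close>.\<close>

lemma sqdist_eqI:
  assumes p: "p \<in> span S" and orth: "\<And>s. s \<in> S \<Longrightarrow> (v - p) \<bullet> s = 0"
  shows "sqdist v S = (norm (v - p))\<^sup>2"
proof -
  have "norm (v - p) \<le> dist v a" if a: "a \<in> span S" for a
  proof -
    have "(v - p) \<bullet> (p - a) = 0"
      by (rule inner_span_eq_0[of _ S]) (use p a orth span_diff in auto)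
    then have "(norm ((v - p) + (p - a)))\<^sup>2 = (norm (v - p))\<^sup>2 + (norm (p - a))\<^sup>2"
      by (intro norm_add_Pythagorean) (simp add: orthogonal_def)
    then have "(norm (v - p))\<^sup>2 \<le> (norm (v - a))\<^sup>2" by simp
    then show ?thesis by (simp add: dist_norm power2_le_iff_abs_le)
  qed
  then have "infdist v (span S) \<ge> norm (v - p)"
    unfolding infdist_def using p by (auto intro!: cINF_greatest)
  moreover have "infdist v (span S) \<le> norm (v - p)"
    using infdist_le[OF p, of v] by (simp add: dist_norm)
  ultimately show ?thesis by (simp add: sqdist_def)
qed

text \<open>Completeness of the type is not assumed; finiteness of \<open>S\<close> gives an
  orthogonal generating set, along which \<open>v\<close> is expanded.\<close>

lemma obtain_projection:
  fixes v :: "'a::real_inner"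
  assumes "finite S"
  obtains p where "p \<in> span S" "\<And>s. s \<in> span S \<Longrightarrow> (v - p) \<bullet> s = 0"
proof -
  obtain C where C: "finite C" "span C = span S" "pairwise orthogonal C"
    using basis_orthogonal[OF assms] by blast
  define p where "p = (\<Sum>b\<in>C. ((b \<bullet> v) / (b \<bullet> b)) *\<^sub>R b)"
  have "(v - p) \<bullet> c = 0" if c: "c \<in> C" for c
  proof -
    have "p \<bullet> c = (\<Sum>b\<in>C. if b = c then c \<bullet> v else 0)"
      unfolding p_def inner_sum_left
    proof (rule sum.cong[OF refl])
      fix b assume "b \<in> C"
      then have "b \<noteq> c \<Longrightarrow> b \<bullet> c = 0"
        using C(3) c by (auto simp: pairwise_def orthogonal_def)
      then show "((b \<bullet> v) / (b \<bullet> b)) *\<^sub>R b \<bullet> c = (if b = c then c \<bullet> v else 0)"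
        by (cases "b = c") auto
    qed
    then show ?thesis using C(1) c by (simp add: inner_diff_left inner_commute[of c v])
  qed
  then have "(v - p) \<bullet> s = 0" if "s \<in> span S" for s
    using inner_span_eq_0[of s C "v - p"] that C(2) by auto
  moreover have "p \<in> span S"
    unfolding p_def C(2)[symmetric] by (intro span_sum span_scale span_base)
  ultimately show ?thesis using that by blast
qed

lemma sqdist_nonneg [simp]: "sqdist v S \<ge> 0"
  by (simp add: sqdist_def)

lemma sqdist_le: "p \<in> span S \<Longrightarrow> sqdist v S \<le> (norm (v - p))\<^sup>2"
  using infdist_le[of p "span S" v] by (simp add: sqdist_def dist_norm infdist_nonneg power_mono)

lemma sqdist_antimono: "S \<subseteq> span T \<Longrightarrow> sqdist v T \<le> sqdist v S"
  using infdist_mono[of "span S" "span T" v] span_zero[of S] span_minimal[of S "span T"]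
  by (auto simp: sqdist_def infdist_nonneg intro!: power_mono)

text \<open>One Gram-Schmidt step: the new vector removes from \<open>v - p\<close> exactly its
  component along \<open>y - q\<close>. The identity is multiplied out to avoid a quotient.\<close>

lemma sqdist_insert:
  fixes v y :: "'a::real_inner"
  assumes p: "p \<in> span S" "\<And>s. s \<in> span S \<Longrightarrow> (v - p) \<bullet> s = 0"
    and q: "q \<in> span S" "\<And>s. s \<in> span S \<Longrightarrow> (y - q) \<bullet> s = 0"
    and "y \<noteq> q"
  shows "sqdist v (insert y S) * (norm (y - q))\<^sup>2 =
    (norm (v - p))\<^sup>2 * (norm (y - q))\<^sup>2 - ((v - p) \<bullet> (y - q))\<^sup>2"
proof -
  define v' y' where "v' = v - p" and "y' = y - q"
  define c where "c = (v' \<bullet> y') / (y' \<bullet> y')"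
  have y': "y' \<bullet> y' \<noteq> 0" using \<open>y \<noteq> q\<close> by (simp add: y'_def)
  have sub: "span S \<subseteq> span (insert y S)" by (intro span_mono) auto
  have "sqdist v (insert y S) = (norm (v - (p + c *\<^sub>R y')))\<^sup>2"
  proof (rule sqdist_eqI)
    show "p + c *\<^sub>R y' \<in> span (insert y S)"
      unfolding y'_def
      by (intro span_add span_scale span_diff) (use p(1) q(1) sub in \<open>auto intro: span_base\<close>)
    have S: "(v - (p + c *\<^sub>R y')) \<bullet> s = 0" if "s \<in> span S" for s
      using p(2)[OF that] q(2)[OF that] by (simp add: y'_def algebra_simps inner_diff_left inner_add_left)
    have "(v - (p + c *\<^sub>R y')) \<bullet> y' = 0"
      using y' by (simp add: c_def v'_def inner_diff_left inner_add_left field_simps)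
    then have "(v - (p + c *\<^sub>R y')) \<bullet> (y' + q) = 0" using S[OF q(1)] by (simp add: inner_add_right)
    then show "(v - (p + c *\<^sub>R y')) \<bullet> s = 0" if "s \<in> insert y S" for s
      using that S[OF span_base] by (auto simp: y'_def)
  qed
  also have "v - (p + c *\<^sub>R y') = v' - c *\<^sub>R y'" by (simp add: v'_def)
  also have "(norm (v' - c *\<^sub>R y'))\<^sup>2 = v' \<bullet> v' - 2 * c * (v' \<bullet> y') + c\<^sup>2 * (y' \<bullet> y')"
    unfolding power2_norm_eq_inner
    by (simp add: inner_diff_left inner_diff_right inner_commute[of y' v'] power2_eq_square algebra_simps)
  finally show ?thesis
    unfolding power2_norm_eq_inner v'_def[symmetric] y'_def[symmetric]
    using y' by (simp add: c_def power2_eq_square field_simps)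
qed

text \<open>Both sides are the Gram determinant of the parts of \<open>v\<close> and
  \<open>y\<close> orthogonal to \<open>span S\<close>, hence symmetric in \<open>v\<close> and
  \<open>y\<close>.\<close>

lemma sqdist_insert_commute:
  fixes v y :: "'a::real_inner"
  assumes "finite S"
  shows "sqdist v (insert y S) * sqdist y S = sqdist y (insert v S) * sqdist v S"
proof -
  obtain p where p: "p \<in> span S" "\<And>s. s \<in> span S \<Longrightarrow> (v - p) \<bullet> s = 0"
    using obtain_projection[OF assms] by blast
  obtain q where q: "q \<in> span S" "\<And>s. s \<in> span S \<Longrightarrow> (y - q) \<bullet> s = 0"
    using obtain_projection[OF assms] by blast
  have vS: "sqdist v S = (norm (v - p))\<^sup>2" and yS: "sqdist y S = (norm (y - q))\<^sup>2"
    by (rule sqdist_eqI; use p q span_base in auto)+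
  have mono: "sqdist u (insert w S) \<le> sqdist u S" for u w :: 'a
    by (rule sqdist_antimono) (auto intro: span_base)
  \<comment> \<open>If \<open>y\<close> or \<open>v\<close> lies in \<open>span S\<close>, both
    products vanish; otherwise \<open>sqdist_insert\<close> applies in both orders.\<close>
  consider "y = q" | "v = p" | "y \<noteq> q" "v \<noteq> p" by blast
  then show ?thesis
  proof cases
    case 1
    then have "sqdist y (insert v S) = 0"
      using mono[of y v] yS by (simp add: order_antisym)
    then show ?thesis using 1 yS by simp
  next
    case 2
    then have "sqdist v (insert y S) = 0"
      using mono[of v y] vS by (simp add: order_antisym)
    then show ?thesis using 2 vS by simp
  next
    case 3
    have "sqdist v (insert y S) * (norm (y - q))\<^sup>2 =
        (norm (v - p))\<^sup>2 * (norm (y - q))\<^sup>2 - ((v - p) \<bullet> (y - q))\<^sup>2"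
      using p q 3(1) by (rule sqdist_insert)
    moreover have "sqdist y (insert v S) * (norm (v - p))\<^sup>2 =
        (norm (y - q))\<^sup>2 * (norm (v - p))\<^sup>2 - ((y - q) \<bullet> (v - p))\<^sup>2"
      using q p 3(2) by (rule sqdist_insert)
    ultimately show ?thesis
      unfolding vS yS by (simp add: inner_commute mult.commute)
  qed
qed

text \<open>The projection of \<open>v\<close> onto \<open>span S\<close> remains its projection
  onto the larger span, because \<open>T\<close> is orthogonal to both \<open>v\<close> and
  \<open>S\<close>.\<close>

lemma sqdist_Un_orthogonal:
  fixes v :: "'a::real_inner"
  assumes "finite S" and "\<And>t. t \<in> T \<Longrightarrow> t \<bullet> v = 0"
    and "\<And>s t. s \<in> S \<Longrightarrow> t \<in> T \<Longrightarrow> t \<bullet> s = 0"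
  shows "sqdist v (S \<union> T) = sqdist v S"
proof -
  obtain p where p: "p \<in> span S" "\<And>s. s \<in> span S \<Longrightarrow> (v - p) \<bullet> s = 0"
    using obtain_projection[OF assms(1)] by blast
  have "(v - p) \<bullet> t = 0" if "t \<in> T" for t
    using assms(2)[OF that] inner_span_eq_0[OF p(1), of t] assms(3)[OF _ that]
    by (simp add: inner_diff_left inner_commute[of v t] inner_commute[of p t])
  then have "sqdist v (S \<union> T) = (norm (v - p))\<^sup>2"
    using p(1) p(2)[OF span_base] span_mono[of S "S \<union> T"] by (intro sqdist_eqI) auto
  also have "\<dots> = sqdist v S" using p span_base by (intro sqdist_eqI[symmetric]) auto
  finally show ?thesis .
qed

lemma sqdist_add_orthogonal:
  fixes v :: "'a::real_inner"
  assumes "finite S" and "z \<bullet> v = 0" and "\<And>s. s \<in> S \<Longrightarrow> z \<bullet> s = 0"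
  shows "sqdist (v + z) S = sqdist v S + (norm z)\<^sup>2"
proof -
  obtain p where p: "p \<in> span S" "\<And>s. s \<in> span S \<Longrightarrow> (v - p) \<bullet> s = 0"
    using obtain_projection[OF assms(1)] by blast
  have zp: "z \<bullet> p = 0" using inner_span_eq_0[OF p(1)] assms(3) by blast
  have "sqdist (v + z) S = (norm (v + z - p))\<^sup>2"
    using p assms(3) span_base by (intro sqdist_eqI) (auto simp: inner_diff_left inner_add_left)
  also have "\<dots> = (norm ((v - p) + z))\<^sup>2" by (simp add: algebra_simps)
  also have "\<dots> = (norm (v - p))\<^sup>2 + (norm z)\<^sup>2"
    using zp assms(2)
    by (intro norm_add_Pythagorean)
      (simp add: orthogonal_def inner_diff_left inner_commute[of v z] inner_commute[of p z])
  also have "(norm (v - p))\<^sup>2 = sqdist v S"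
    using p span_base by (intro sqdist_eqI[symmetric]) auto
  finally show ?thesis .
qed

text \<open>The observations \<open>x + z l\<close> are equivalent to their combination with weights inversely
  proportional to the noise variances, together with differences orthogonal to everything else.\<close>

lemma sqdist_noisy_observations:
  fixes m x :: "'a::real_inner" and z :: "'b \<Rightarrow> 'a"
  assumes "finite U" "finite I" "I \<noteq> {}"
    and zz: "\<And>l l'. l \<in> I \<Longrightarrow> l' \<in> I \<Longrightarrow> l \<noteq> l' \<Longrightarrow> z l \<bullet> z l' = 0"
    and z0: "\<And>l. l \<in> I \<Longrightarrow> z l \<noteq> 0"
    and zm: "\<And>l. l \<in> I \<Longrightarrow> z l \<bullet> m = 0"
    and zx: "\<And>l. l \<in> I \<Longrightarrow> z l \<bullet> x = 0"
    and zU: "\<And>l u. l \<in> I \<Longrightarrow> u \<in> U \<Longrightarrow> z l \<bullet> u = 0"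
  defines "N \<equiv> inverse (\<Sum>l\<in>I. inverse ((norm (z l))\<^sup>2))"
  shows "sqdist m (U \<union> (\<lambda>l. x + z l) ` I) * (sqdist x U + N) = sqdist m U * (sqdist x (insert m U) + N)"
proof -
  \<comment> \<open>Weights proportional to the inverse variances sum to 1 and make
    \<open>z l \<bullet> w = N\<close> for every \<open>l\<close>. Hence
    \<open>w \<bullet> w = N\<close> and each \<open>z l - w\<close> is orthogonal to
    \<open>w\<close>.\<close>
  define c where "c l = N * inverse ((norm (z l))\<^sup>2)" for l
  define w where "w = (\<Sum>l\<in>I. c l *\<^sub>R z l)"
  have Spos: "(\<Sum>l\<in>I. inverse ((norm (z l))\<^sup>2)) > 0"
    using assms(2,3) z0 by (intro sum_pos) auto
  then have c1: "(\<Sum>l\<in>I. c l) = 1"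
    by (simp add: c_def sum_distrib_left[symmetric] N_def)
  have zw: "z l \<bullet> w = N" if l: "l \<in> I" for l
  proof -
    have "z l \<bullet> w = (\<Sum>i\<in>I. if i = l then N else 0)"
      unfolding w_def inner_sum_right
    proof (rule sum.cong[OF refl])
      fix i assume "i \<in> I"
      then show "z l \<bullet> c i *\<^sub>R z i = (if i = l then N else 0)"
        using zz[OF l, of i] z0[OF l] by (auto simp: c_def power2_norm_eq_inner)
    qed
    then show ?thesis using assms(2) l by simp
  qed
  have wu: "w \<bullet> u = 0" if "\<And>l. l \<in> I \<Longrightarrow> z l \<bullet> u = 0" for u
    using that by (simp add: w_def inner_sum_left)
  have "w \<bullet> w = (\<Sum>l\<in>I. c l * (z l \<bullet> w))" by (subst (1) w_def) (simp add: inner_sum_left)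
  also have "\<dots> = N" using zw c1 by (simp add: sum_distrib_right[symmetric])
  finally have ww: "w \<bullet> w = N" .
  define D where "D = (\<lambda>l. z l - w) ` I"
  define Y where "Y = (\<lambda>l. x + z l) ` I"
  \<comment> \<open>A change of generators: the outputs span, together with \<open>U\<close>, the
    same space as the averaged output \<open>x + w\<close> and the differences in \<open>D\<close>.
    The latter are orthogonal to \<open>m\<close>, \<open>U\<close> and \<open>x + w\<close>, so
    they drop out.\<close>
  have span1: "U \<union> Y \<subseteq> span (insert (x + w) U \<union> D)"
  proof -
    have "x + z l \<in> span (insert (x + w) U \<union> D)" if "l \<in> I" for l
    proof -
      have "(x + w) + (z l - w) \<in> span (insert (x + w) U \<union> D)"
        using that by (intro span_add span_base) (auto simp: D_def)
      then show ?thesis by simp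
    qed
    then show ?thesis by (auto simp: Y_def intro: span_base)
  qed
  have "x + w = (\<Sum>l\<in>I. c l *\<^sub>R (x + z l))"
    using c1 by (simp add: w_def scaleR_right_distrib sum.distrib scaleR_sum_left[symmetric])
  then have xw: "x + w \<in> span (U \<union> Y)"
    by (simp add: Y_def) (intro span_sum span_scale span_base, auto)
  have span2: "insert (x + w) U \<union> D \<subseteq> span (U \<union> Y)"
  proof -
    have "z l - w \<in> span (U \<union> Y)" if "l \<in> I" for l
    proof -
      have "(x + z l) - (x + w) \<in> span (U \<union> Y)"
        using that xw by (intro span_diff) (auto simp: Y_def intro: span_base)
      then show ?thesis by simp
    qed
    then show ?thesis using xw by (auto simp: D_def intro: span_base)
  qed
  have "sqdist m (U \<union> Y) = sqdist m (insert (x + w) U \<union> D)"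
    using sqdist_antimono[OF span1] sqdist_antimono[OF span2] by (simp add: order_antisym)
  also have "\<dots> = sqdist m (insert (x + w) U)"
  proof (rule sqdist_Un_orthogonal)
    show "finite (insert (x + w) U)" using assms(1) by simp
    show "t \<bullet> m = 0" if "t \<in> D" for t
      using that zm wu[OF zm] by (auto simp: D_def inner_diff_left)
    fix s t assume s: "s \<in> insert (x + w) U" and "t \<in> D"
    then obtain l where l: "l \<in> I" "t = z l - w" by (auto simp: D_def)
    have "t \<bullet> (x + w) = 0"
      using l zx wu[OF zx] zw ww by (simp add: inner_diff_left inner_add_right)
    moreover have "t \<bullet> u = 0" if "u \<in> U" for u
      using l zU[OF _ that] wu[OF zU[OF _ that]] by (simp add: inner_diff_left)
    ultimately show "t \<bullet> s = 0" using s by auto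
  qed
  \<comment> \<open>Symmetry of the Gram determinant trades the distance of \<open>m\<close> for
    that of \<open>x + w\<close>, where the noise \<open>w\<close> adds its full energy.\<close>
  finally have "sqdist m (U \<union> Y) * sqdist (x + w) U = sqdist (x + w) (insert m U) * sqdist m U"
    using sqdist_insert_commute[OF assms(1), of m "x + w"] by simp
  moreover have "sqdist (x + w) U = sqdist x U + (norm w)\<^sup>2"
    using assms(1) wu[OF zx] wu[OF zU] by (intro sqdist_add_orthogonal) auto
  moreover have "sqdist (x + w) (insert m U) = sqdist x (insert m U) + (norm w)\<^sup>2"
    using assms(1) wu[OF zx] wu[OF zU] wu[OF zm] by (intro sqdist_add_orthogonal) auto
  ultimately show ?thesis using ww by (simp add: power2_norm_eq_inner mult.commute Y_def)
qed

section \<open>Degraded observations\<close>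

text \<open>\<open>residual k j\<close> is the squared distance of the input \<open>x j\<close> from the span of the
  messages \<open>m 1, \<dots>, m k\<close> and of what the receivers \<open>1, \<dots>, k\<close> have observed
  before time \<open>j\<close>; it is the paper's conditional variance for the degraded channel in which
  receiver \<open>k\<close> also sees the outputs of the receivers before it.\<close>

locale degraded_observations =
  fixes K :: nat and m x :: "nat \<Rightarrow> 'a::real_inner" and z :: "nat \<Rightarrow> nat \<Rightarrow> 'a"
  assumes mm: "\<And>k l. k \<in> {1..K} \<Longrightarrow> l \<in> {1..K} \<Longrightarrow> k \<noteq> l \<Longrightarrow> m k \<bullet> m l = 0"
    and zm: "\<And>k j l. k \<in> {1..K} \<Longrightarrow> l \<in> {1..K} \<Longrightarrow> z k j \<bullet> m l = 0"
    and zz: "\<And>k j l i. k \<in> {1..K} \<Longrightarrow> l \<in> {1..K} \<Longrightarrow> (k, j) \<noteq> (l, i) \<Longrightarrow> z k j \<bullet> z l i = 0"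
    and zx: "\<And>k j i. k \<in> {1..K} \<Longrightarrow> i \<le> j \<Longrightarrow> z k j \<bullet> x i = 0"
    and z_nonzero: "\<And>k j. k \<in> {1..K} \<Longrightarrow> z k j \<noteq> 0"
begin

definition obs :: "nat \<Rightarrow> nat \<Rightarrow> 'a set" where
  "obs k j = (\<lambda>(l, i). x i + z l i) ` ({1..k} \<times> {..<j})"

definition residual :: "nat \<Rightarrow> nat \<Rightarrow> real" where
  "residual k j = sqdist (x j) (m ` {1..k} \<union> obs k j)"

text \<open>The noise energy left after optimally averaging the outputs of receivers 1 to
  \<open>k\<close>. It depends on the time \<open>j\<close> because half of the noise of one slot
  per receiver will be turned into a message.\<close>

definition joint_noise :: "nat \<Rightarrow> nat \<Rightarrow> real" where
  "joint_noise k j = inverse (\<Sum>l\<in>{1..k}. inverse ((norm (z l j))\<^sup>2))"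

lemma finite_obs [simp]: "finite (obs k j)"
  by (simp add: obs_def)

lemma obs_Suc: "obs k (Suc j) = obs k j \<union> (\<lambda>l. x j + z l j) ` {1..k}"
  unfolding obs_def by (auto simp: lessThan_Suc image_iff)

lemma z_obs:
  assumes "l \<in> {1..K}" "k \<le> K" "u \<in> obs k j"
  shows "z l j \<bullet> u = 0"
  using assms by (auto simp: obs_def inner_add_right zx zz)

lemma joint_noise_pos:
  assumes "k \<in> {1..K}"
  shows "joint_noise k j > 0"
proof -
  have "(\<Sum>l\<in>{1..k}. inverse ((norm (z l j))\<^sup>2)) > 0"
    using assms z_nonzero by (intro sum_pos) auto
  then show ?thesis by (simp add: joint_noise_def)
qed

lemma residual_nonneg [simp]: "residual k j \<ge> 0"
  by (simp add: residual_def)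

lemma residual_0: "residual 0 j \<le> (norm (x j))\<^sup>2"
  using sqdist_le[of 0 _ "x j"] by (simp add: residual_def span_zero)

text \<open>This is \<open>sqdist_noisy_observations\<close> with the earlier messages and the past
  outputs as \<open>U\<close>. Only an inequality remains, since \<open>residual (k - 1) j\<close>
  does not use the past of receiver \<open>k\<close> itself.\<close>

lemma sqdist_obs_step:
  assumes k: "k \<in> {1..K}"
  shows "sqdist (m k) (m ` {1..k - 1} \<union> obs k j) * (residual k j + joint_noise k j)
    \<le> sqdist (m k) (m ` {1..k - 1} \<union> obs k (Suc j)) * (residual (k - 1) j + joint_noise k j)"
proof -
  let ?U = "m ` {1..k - 1} \<union> obs k j"
  have "sqdist (m k) (?U \<union> (\<lambda>l. x j + z l j) ` {1..k}) * (sqdist (x j) ?U + joint_noise k j)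
      = sqdist (m k) ?U * (sqdist (x j) (insert (m k) ?U) + joint_noise k j)"
    unfolding joint_noise_def
  proof (rule sqdist_noisy_observations)
    fix l u assume l: "l \<in> {1..k}" and u: "u \<in> m ` {1..k - 1} \<union> obs k j"
    have "l \<in> {1..K}" "k \<le> K" using l k by auto
    then show "z l j \<bullet> u = 0" using u zm z_obs by fastforce
  qed (use k zz zm zx z_nonzero in auto)
  moreover have "?U \<union> (\<lambda>l. x j + z l j) ` {1..k} = m ` {1..k - 1} \<union> obs k (Suc j)"
    by (auto simp: obs_Suc)
  moreover have "insert (m k) ?U = m ` {1..k} \<union> obs k j"
  proof -
    have "{1..k} = insert k {1..k - 1}" using k by auto
    then show ?thesis by simp
  qed
  moreover have "sqdist (x j) ?U \<le> residual (k - 1) j"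
    unfolding residual_def
  proof (rule sqdist_antimono)
    have "obs (k - 1) j \<subseteq> obs k j" unfolding obs_def by (intro image_mono Sigma_mono) auto
    then show "m ` {1..k - 1} \<union> obs (k - 1) j \<subseteq> span ?U" using span_superset[of ?U] by blast
  qed
  ultimately show ?thesis
    by (simp add: residual_def[of k]) (metis add_le_cancel_right mult_left_mono sqdist_nonneg)
qed

text \<open>The one-step bound is iterated over time. The start value is
  \<open>(norm (m k))\<^sup>2\<close> because \<open>m k\<close> is orthogonal to the other
  messages.\<close>

theorem converse_product:
  assumes k: "k \<in> {1..K}"
  shows "(norm (m k))\<^sup>2 * (\<Prod>j<n. (residual k j + joint_noise k j) / (residual (k - 1) j + joint_noise k j))
    \<le> sqdist (m k) (m ` {1..k - 1} \<union> obs k n)"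
proof (induction n)
  case 0
  have "sqdist (m k) (m ` {1..k - 1}) = (norm (m k - 0))\<^sup>2"
  proof (rule sqdist_eqI[OF span_zero])
    fix s assume "s \<in> m ` {1..k - 1}"
    then obtain l where "l \<in> {1..k - 1}" "s = m l" by auto
    then have "l \<in> {1..K}" "k \<noteq> l" "s = m l" using k by auto
    then show "(m k - 0) \<bullet> s = 0" using mm[OF k] by simp
  qed
  then show ?case by (simp add: obs_def)
next
  case (Suc j)
  let ?r = "(residual k j + joint_noise k j) / (residual (k - 1) j + joint_noise k j)"
  have pos: "residual (k - 1) j + joint_noise k j > 0" "residual k j + joint_noise k j > 0"
    using joint_noise_pos[OF k, of j] by (auto intro!: add_nonneg_pos)
  have "sqdist (m k) (m ` {1..k - 1} \<union> obs k j) * ?r \<le> sqdist (m k) (m ` {1..k - 1} \<union> obs k (Suc j))"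
    using sqdist_obs_step[OF k, of j] pos by (simp add: field_simps)
  moreover have "(norm (m k))\<^sup>2 * (\<Prod>j<j. (residual k j + joint_noise k j) / (residual (k - 1) j + joint_noise k j)) * ?r
      \<le> sqdist (m k) (m ` {1..k - 1} \<union> obs k j) * ?r"
    using Suc pos by (intro mult_right_mono) auto
  ultimately show ?case by (simp add: mult.assoc)
qed

text \<open>The vector \<open>- p\<close> is a linear estimate of \<open>m k\<close> with error at
  most \<open>d\<close>, so the distance bounded below by \<open>converse_product\<close> is at most
  \<open>d\<close>. Inverting the product and taking logarithms gives the gain.\<close>

corollary converse_ln:
  assumes k: "k \<in> {1..K}" and p: "p \<in> span (obs k n)" "norm (m k + p) \<le> d" and "m k \<noteq> 0" "d > 0"
  shows "ln ((norm (m k))\<^sup>2 / d\<^sup>2)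
    \<le> (\<Sum>j<n. ln ((residual (k - 1) j + joint_noise k j) / (residual k j + joint_noise k j)))"
proof -
  let ?P = "\<Prod>j<n. (residual (k - 1) j + joint_noise k j) / (residual k j + joint_noise k j)"
  have pos: "residual (k - 1) j + joint_noise k j > 0" "residual k j + joint_noise k j > 0" for j
    using joint_noise_pos[OF k, of j] by (auto intro!: add_nonneg_pos)
  have "- p \<in> span (m ` {1..k - 1} \<union> obs k n)"
    using p(1) span_mono[of "obs k n" "m ` {1..k - 1} \<union> obs k n"] by (auto intro: span_neg)
  then have "sqdist (m k) (m ` {1..k - 1} \<union> obs k n) \<le> (norm (m k - (- p)))\<^sup>2" by (rule sqdist_le)
  also have "\<dots> \<le> d\<^sup>2" using p(2) by (intro power_mono) auto
  finally have "(norm (m k))\<^sup>2 * (\<Prod>j<n. (residual k j + joint_noise k j) / (residual (k - 1) j + joint_noise k j)) \<le> d\<^sup>2"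
    using converse_product[OF k, of n] by linarith
  moreover have "(\<Prod>j<n. (residual k j + joint_noise k j) / (residual (k - 1) j + joint_noise k j)) = inverse ?P"
    by (simp add: prod_inversef[symmetric])
  moreover have "?P > 0" using pos by (intro prod_pos) (auto intro!: divide_pos_pos)
  ultimately have "(norm (m k))\<^sup>2 / d\<^sup>2 \<le> ?P" using assms(5) by (simp add: field_simps)
  then have "ln ((norm (m k))\<^sup>2 / d\<^sup>2) \<le> ln ?P"
    using assms(4,5) \<open>?P > 0\<close> by (intro ln_mono) auto
  also have "ln ?P = (\<Sum>j<n. ln ((residual (k - 1) j + joint_noise k j) / (residual k j + joint_noise k j)))"
    by (intro ln_prod) (use pos[THEN less_imp_neq, THEN not_sym] in auto)
  finally show ?thesis .
qed

end

section \<open>Duality between noise shifts and linear combinations of outputs\<close>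

text \<open>Coefficients are indexed by \<open>J\<close> rather than by the image, so
  \<open>f\<close> may repeat values.\<close>

lemma span_image_sum:
  fixes f :: "'b \<Rightarrow> 'a::real_vector"
  assumes "finite J" "q \<in> span (f ` J)"
  obtains w where "q = (\<Sum>j\<in>J. w j *\<^sub>R f j)"
proof -
  have "subspace {\<Sum>j\<in>J. w j *\<^sub>R f j | w. True}" (is "subspace ?S")
    unfolding subspace_def
  proof (intro conjI ballI allI)
    show "0 \<in> ?S" by (auto intro: exI[of _ "\<lambda>_. 0"])
    fix u assume "u \<in> ?S"
    then obtain a where a: "u = (\<Sum>j\<in>J. a j *\<^sub>R f j)" by blast
    show "c *\<^sub>R u \<in> ?S" for c
      by (auto simp: a scaleR_sum_right intro!: exI[of _ "\<lambda>j. c * a j"])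
    fix v assume "v \<in> ?S"
    then obtain b where b: "v = (\<Sum>j\<in>J. b j *\<^sub>R f j)" by blast
    show "u + v \<in> ?S"
      by (auto simp: a b scaleR_left_distrib sum.distrib intro!: exI[of _ "\<lambda>j. a j + b j"])
  qed
  moreover have "f ` J \<subseteq> ?S"
  proof
    fix u assume "u \<in> f ` J"
    then obtain i where i: "i \<in> J" "u = f i" by blast
    have "(\<Sum>j\<in>J. (if j = i then 1 else 0) *\<^sub>R f j) = (\<Sum>j\<in>J. if j = i then f j else 0)"
      by (intro sum.cong) auto
    also have "\<dots> = u" using assms(1) i by simp
    finally show "u \<in> ?S" by (auto intro!: exI[of _ "\<lambda>j. if j = i then 1 else 0"])
  qed
  ultimately have "q \<in> ?S" using span_minimal[of "f ` J" ?S] assms(2) by blast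
  then show ?thesis using that by blast
qed

text \<open>Both sides are read off the orthogonal projection of \<open>(0, 1)\<close> onto the span of the
  pairs \<open>(r j, d j)\<close>.\<close>

lemma dual_combination:
  fixes r :: "'b \<Rightarrow> 'a::real_inner" and d :: "'b \<Rightarrow> real"
  assumes "finite J" "t > 0"
    and bound: "\<And>s. s \<in> span (r ` J) \<Longrightarrow> (\<And>j. j \<in> J \<Longrightarrow> r j \<bullet> s = d j) \<Longrightarrow> norm s \<ge> t"
  obtains w where "(\<Sum>j\<in>J. w j * d j) = 1" "norm (\<Sum>j\<in>J. w j *\<^sub>R r j) \<le> 1 / t"
proof -
  let ?f = "\<lambda>j. (r j, d j)"
  obtain q where q: "q \<in> span (?f ` J)" "\<And>s. s \<in> span (?f ` J) \<Longrightarrow> ((0, 1) - q) \<bullet> s = 0"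
    using obtain_projection[of "?f ` J" "(0, 1)"] assms(1) by auto
  obtain w where w: "q = (\<Sum>j\<in>J. w j *\<^sub>R ?f j)"
    using span_image_sum[OF assms(1) q(1)] by blast
  define p where "p = (\<Sum>j\<in>J. w j *\<^sub>R r j)"
  define e where "e = (\<Sum>j\<in>J. w j * d j)"
  have "q = (p, e)" unfolding w p_def e_def by (auto simp: prod_eq_iff fst_sum snd_sum)
  \<comment> \<open>Unless \<open>e = 1\<close>, rescaling \<open>p\<close> by
    \<open>1 / (1 - e)\<close> yields a vector to which \<open>bound\<close> applies.\<close>
  then have orth: "r j \<bullet> p = (1 - e) * d j" if "j \<in> J" for j
    using q(2)[OF span_base, of "?f j"] that by (auto simp: inner_commute mult.commute)
  have "p \<bullet> p = (\<Sum>j\<in>J. w j * (r j \<bullet> p))" by (subst (1) p_def) (simp add: inner_sum_left)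
  also have "\<dots> = (\<Sum>j\<in>J. w j * ((1 - e) * d j))" using orth by simp
  also have "\<dots> = (1 - e) * (\<Sum>j\<in>J. w j * d j)" by (simp add: sum_distrib_left mult_ac)
  also have "\<dots> = (1 - e) * e" by (simp add: e_def)
  finally have pp: "(norm p)\<^sup>2 = (1 - e) * e" by (simp add: power2_norm_eq_inner)
  show ?thesis
  proof (cases "e = 1")
    \<comment> \<open>Here the combination is free of noise, and \<open>w\<close> itself
      serves.\<close>
    case True
    then have "p = 0" using pp by simp
    then show ?thesis using True \<open>t > 0\<close> by (intro that[of w]) (auto simp: e_def p_def)
  next
    case False
    let ?s = "(1 / (1 - e)) *\<^sub>R p"
    have "p \<in> span (r ` J)" unfolding p_def by (intro span_sum span_scale span_base) auto
    then have "?s \<in> span (r ` J)" by (rule span_scale)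
    then have "t \<le> norm ?s" using orth False by (intro bound) auto
    then have "t * \<bar>1 - e\<bar> \<le> norm p" using False by (simp add: field_simps)
    then have "(t * \<bar>1 - e\<bar>)\<^sup>2 \<le> (norm p)\<^sup>2" using \<open>t > 0\<close> by (intro power_mono) auto
    then have le: "t\<^sup>2 * (1 - e)\<^sup>2 \<le> (norm p)\<^sup>2" by (simp add: power_mult_distrib)
    then have pos: "(norm p)\<^sup>2 > 0" using False \<open>t > 0\<close>
      by (smt (verit) mult_pos_pos zero_less_power2)
    then have e: "e \<noteq> 0" using pp by auto
    \<comment> \<open>Multiplying by \<open>e\<^sup>2\<close> turns
      \<open>(1 - e)\<^sup>2 * e\<^sup>2\<close> into the fourth power of \<open>norm p\<close>;
      cancelling \<open>(norm p)\<^sup>2\<close> leaves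
      \<open>t * norm p \<le> \<bar>e\<bar>\<close>, so dividing \<open>w\<close> by
      \<open>e\<close> normalises it.\<close>
    have "t\<^sup>2 * (1 - e)\<^sup>2 * e\<^sup>2 \<le> (norm p)\<^sup>2 * e\<^sup>2" using le by (intro mult_right_mono) auto
    moreover have "t\<^sup>2 * (1 - e)\<^sup>2 * e\<^sup>2 = (norm p)\<^sup>2 * (t\<^sup>2 * (norm p)\<^sup>2)"
      unfolding pp by (simp add: power2_eq_square)
    ultimately have "(t * norm p)\<^sup>2 \<le> \<bar>e\<bar>\<^sup>2" using pos by (simp add: power_mult_distrib)
    then have "t * norm p \<le> \<bar>e\<bar>" by (rule power2_le_imp_le) simp
    then have n: "norm ((1 / e) *\<^sub>R p) \<le> 1 / t" using e \<open>t > 0\<close> by (simp add: field_simps)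
    have "(\<Sum>j\<in>J. (w j / e) * d j) = (\<Sum>j\<in>J. w j * d j) / e"
      by (simp add: sum_divide_distrib)
    then have "(\<Sum>j\<in>J. (w j / e) * d j) = 1" using e by (simp add: e_def)
    moreover have "(\<Sum>j\<in>J. (w j / e) *\<^sub>R r j) = (1 / e) *\<^sub>R p"
      by (simp add: p_def scaleR_sum_right)
    ultimately show ?thesis using n e by (intro that[of "\<lambda>j. w j / e"]) auto
  qed
qed

text \<open>Linear combinations of the noises are modelled by finitely supported functions, since these
  contain orthogonal families of every finite size in a single real inner product type.\<close>

instantiation poly_mapping :: (type, real_vector) real_vector
begin

lift_definition scaleR_poly_mapping :: "real \<Rightarrow> ('a \<Rightarrow>\<^sub>0 'b) \<Rightarrow> ('a \<Rightarrow>\<^sub>0 'b)"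
  is "\<lambda>c f k. c *\<^sub>R f k"
proof -
  fix c :: real and f :: "'a \<Rightarrow> 'b" assume "finite {k. f k \<noteq> 0}"
  then show "finite {k. c *\<^sub>R f k \<noteq> 0}" by (rule rev_finite_subset) auto
qed

instance
  by standard (transfer, simp add: scaleR_add_right scaleR_add_left fun_eq_iff)+

end

instantiation poly_mapping :: (type, real_inner) real_inner
begin

definition inner_poly_mapping :: "('a \<Rightarrow>\<^sub>0 'b) \<Rightarrow> ('a \<Rightarrow>\<^sub>0 'b) \<Rightarrow> real" where
  "inner_poly_mapping f g = (\<Sum>k\<in>Poly_Mapping.keys f. Poly_Mapping.lookup f k \<bullet> Poly_Mapping.lookup g k)"

definition norm_poly_mapping :: "('a \<Rightarrow>\<^sub>0 'b) \<Rightarrow> real" where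
  "norm_poly_mapping f = sqrt (f \<bullet> f)"

definition dist_poly_mapping :: "('a \<Rightarrow>\<^sub>0 'b) \<Rightarrow> ('a \<Rightarrow>\<^sub>0 'b) \<Rightarrow> real" where
  "dist_poly_mapping f g = norm (f - g)"

definition sgn_poly_mapping :: "('a \<Rightarrow>\<^sub>0 'b) \<Rightarrow> ('a \<Rightarrow>\<^sub>0 'b)" where
  "sgn_poly_mapping f = f /\<^sub>R norm f"

definition uniformity_poly_mapping :: "(('a \<Rightarrow>\<^sub>0 'b) \<times> ('a \<Rightarrow>\<^sub>0 'b)) filter" where
  "uniformity_poly_mapping = (INF e\<in>{0 <..}. principal {(f, g). dist f g < e})"

definition open_poly_mapping :: "('a \<Rightarrow>\<^sub>0 'b) set \<Rightarrow> bool" where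
  "open_poly_mapping U \<longleftrightarrow> (\<forall>f\<in>U. eventually (\<lambda>(f', g). f' = f \<longrightarrow> g \<in> U) uniformity)"

lemma inner_poly_mapping_superset:
  assumes "finite A" "Poly_Mapping.keys f \<subseteq> A"
  shows "f \<bullet> g = (\<Sum>k\<in>A. Poly_Mapping.lookup f k \<bullet> Poly_Mapping.lookup g k)"
  unfolding inner_poly_mapping_def
  using assms by (intro sum.mono_neutral_left) (auto simp: in_keys_iff)

instance
proof
  fix f g h :: "'a \<Rightarrow>\<^sub>0 'b" and c :: real
  define A where "A = Poly_Mapping.keys f \<union> Poly_Mapping.keys g"
  have A: "finite A" "Poly_Mapping.keys f \<subseteq> A" "Poly_Mapping.keys g \<subseteq> A"
    "Poly_Mapping.keys (f + g) \<subseteq> A"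
    using Poly_Mapping.keys_add[of f g] by (auto simp: A_def)
  note S = inner_poly_mapping_superset[OF A(1)]
  show "f \<bullet> g = g \<bullet> f" using A by (simp add: S inner_commute)
  show "(f + g) \<bullet> h = f \<bullet> h + g \<bullet> h"
    using A by (simp add: S lookup_add inner_add_left sum.distrib)
  have "Poly_Mapping.keys (c *\<^sub>R f) \<subseteq> Poly_Mapping.keys f"
    by (auto simp: in_keys_iff scaleR_poly_mapping.rep_eq)
  then show "(c *\<^sub>R f) \<bullet> g = c * (f \<bullet> g)"
    using A by (simp add: S scaleR_poly_mapping.rep_eq sum_distrib_left)
  show "0 \<le> f \<bullet> f" by (simp add: inner_poly_mapping_def sum_nonneg)
  show "(f \<bullet> f = 0) = (f = 0)"
    by (auto simp: inner_poly_mapping_def sum_nonneg_eq_0_iff in_keys_iff intro!: poly_mapping_eqI)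
qed (simp_all add: norm_poly_mapping_def dist_poly_mapping_def sgn_poly_mapping_def
    uniformity_poly_mapping_def open_poly_mapping_def)

end

lemma inner_single:
  "Poly_Mapping.single i c \<bullet> Poly_Mapping.single j d = (if i = j then c \<bullet> d else 0)"
  by (auto simp: inner_poly_mapping_def lookup_single when_def)

section \<open>Shifted Gaussian noise\<close>

abbreviation gauss :: "real \<Rightarrow> real \<Rightarrow> real measure" where
  "gauss \<mu> \<sigma> \<equiv> density lborel (normal_density \<mu> \<sigma>)"

lemma gauss_shift:
  assumes "\<sigma> > 0"
  shows "distr (gauss 0 \<sigma>) borel (\<lambda>x. x + s) = gauss s \<sigma>"
proof -
  interpret prob_space "gauss 0 \<sigma>" using assms by (rule prob_space_normal_density)
  have "distributed (gauss 0 \<sigma>) lborel (\<lambda>x. x) (normal_density 0 \<sigma>)"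
    by (auto simp: distributed_def intro!: distr_id2)
  from normal_density_affine[OF this assms, of 1 s]
  have "distributed (gauss 0 \<sigma>) lborel (\<lambda>x. x + s) (normal_density s \<sigma>)"
    by (simp add: add.commute)
  then have "distr (gauss 0 \<sigma>) lborel (\<lambda>x. x + s) = gauss s \<sigma>"
    by (rule distributed_distr_eq_density)
  moreover have "distr (gauss 0 \<sigma>) borel (\<lambda>x. x + s) = distr (gauss 0 \<sigma>) lborel (\<lambda>x. x + s)"
    by (rule distr_cong) auto
  ultimately show ?thesis by simp
qed

text \<open>Completing the square in the exponent.\<close>

lemma gauss_tilt:
  assumes "\<sigma> > 0"
  shows "density (gauss 0 \<sigma>) (\<lambda>x. ennreal (exp (s * x / \<sigma>\<^sup>2 - s\<^sup>2 / (2 * \<sigma>\<^sup>2)))) = gauss s \<sigma>"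
proof -
  have "normal_density 0 \<sigma> x * exp (s * x / \<sigma>\<^sup>2 - s\<^sup>2 / (2 * \<sigma>\<^sup>2)) = normal_density s \<sigma> x" for x
  proof -
    have "- x\<^sup>2 / (2 * \<sigma>\<^sup>2) + (s * x / \<sigma>\<^sup>2 - s\<^sup>2 / (2 * \<sigma>\<^sup>2)) = - (x - s)\<^sup>2 / (2 * \<sigma>\<^sup>2)"
      using assms by (simp add: field_simps power2_eq_square)
    then show ?thesis by (simp add: normal_density_def exp_add[symmetric])
  qed
  then show ?thesis
    by (subst density_density_eq) (auto simp: ennreal_mult[symmetric])
qed

lemma gauss_second_moment:
  assumes "\<sigma> > 0"
  shows "(\<integral>\<^sup>+x. ennreal ((a + c * x)\<^sup>2) \<partial>gauss 0 \<sigma>) = ennreal (a\<^sup>2 + c\<^sup>2 * \<sigma>\<^sup>2)"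
proof -
  have 0: "has_bochner_integral lborel (normal_density 0 \<sigma>) 1"
    using assms by (simp add: has_bochner_integral_iff)
  have 1: "has_bochner_integral lborel (\<lambda>x. normal_density 0 \<sigma> x * x) 0"
    using assms by (rule normal_moment_nz_1)
  have 2: "has_bochner_integral lborel (\<lambda>x. normal_density 0 \<sigma> x * x\<^sup>2) (\<sigma>\<^sup>2)"
    using normal_moment_even[OF assms, of 0 1] by (simp add: fact_numeral)
  have "has_bochner_integral lborel
      (\<lambda>x. a\<^sup>2 * normal_density 0 \<sigma> x + 2 * a * c * (normal_density 0 \<sigma> x * x) + c\<^sup>2 * (normal_density 0 \<sigma> x * x\<^sup>2))
      (a\<^sup>2 * 1 + 2 * a * c * 0 + c\<^sup>2 * \<sigma>\<^sup>2)"
    by (intro has_bochner_integral_add has_bochner_integral_mult_right 0 1 2)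
  then have h: "has_bochner_integral lborel (\<lambda>x. normal_density 0 \<sigma> x * (a + c * x)\<^sup>2) (a\<^sup>2 + c\<^sup>2 * \<sigma>\<^sup>2)"
    by (simp add: power2_eq_square algebra_simps)
  have "(\<integral>\<^sup>+x. ennreal ((a + c * x)\<^sup>2) \<partial>gauss 0 \<sigma>) =
      (\<integral>\<^sup>+x. ennreal (normal_density 0 \<sigma> x * (a + c * x)\<^sup>2) \<partial>lborel)"
    by (subst nn_integral_density) (auto simp: ennreal_mult[symmetric])
  also have "\<dots> = ennreal (a\<^sup>2 + c\<^sup>2 * \<sigma>\<^sup>2)"
    using h by (subst nn_integral_eq_integral) (auto simp: has_bochner_integral_iff)
  finally show ?thesis .
qed

locale gaussian_noise =
  fixes I :: "'i set" and v :: "'i \<Rightarrow> real"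
  assumes fin: "finite I" and v_pos: "\<And>p. v p > 0"
begin

definition noise :: "('i \<Rightarrow> real) measure" where
  "noise = PiM I (\<lambda>p. gauss 0 (sqrt (v p)))"

text \<open>The Cameron-Martin likelihood ratio of the noise shifted by \<open>s\<close> to the
  unshifted noise.\<close>

definition shift_density :: "('i \<Rightarrow> real) \<Rightarrow> ('i \<Rightarrow> real) \<Rightarrow> real" where
  "shift_density s z = exp (\<Sum>p\<in>I. s p * z p / v p - (s p)\<^sup>2 / (2 * v p))"

definition shift :: "('i \<Rightarrow> real) \<Rightarrow> ('i \<Rightarrow> real) \<Rightarrow> ('i \<Rightarrow> real)" where
  "shift s z = (\<lambda>p\<in>I. z p + s p)"

lemma sets_noise [measurable_cong]: "sets noise = sets (PiM I (\<lambda>_. borel))"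
  unfolding noise_def by (intro sets_PiM_cong) auto

lemma space_noise: "space noise = extensional I"
  unfolding noise_def by (auto simp: space_PiM PiE_def)

lemma prob_gauss: "prob_space (gauss \<mu> (sqrt (v p)))"
  using v_pos by (intro prob_space_normal_density) auto

lemma product_sigma_finite_gauss: "product_sigma_finite (\<lambda>p. gauss (s p) (sqrt (v p)))"
  using prob_gauss by (simp add: product_sigma_finite_def prob_space_imp_sigma_finite)

lemma prob_space_noise: "prob_space noise"
  unfolding noise_def using prob_gauss by (rule prob_space_PiM)

lemma measurable_shift [measurable]: "shift s \<in> measurable noise noise"
  unfolding shift_def by measurable

lemma measurable_shift_density [measurable]: "shift_density s \<in> borel_measurable noise"
  unfolding shift_density_def by measurable

text \<open>The product of shifted Gaussians is obtained here as an image measure and in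
  \<open>density_shift\<close> as a density. Together they give the change of measure in
  \<open>emeasure_shifted_event\<close>.\<close>

lemma distr_shift: "distr noise noise (shift s) = PiM I (\<lambda>p. gauss (s p) (sqrt (v p)))"
proof (rule product_sigma_finite.PiM_eqI[OF product_sigma_finite_gauss fin])
  show "sets (distr noise noise (shift s)) = sets (PiM I (\<lambda>p. gauss (s p) (sqrt (v p))))"
    by (simp add: sets_noise) (intro sets_PiM_cong, auto)
  fix A assume A: "\<And>p. p \<in> I \<Longrightarrow> A p \<in> sets (gauss (s p) (sqrt (v p)))"
  then have [measurable]: "p \<in> I \<Longrightarrow> A p \<in> sets borel" for p by simp
  have "shift s -` Pi\<^sub>E I A \<inter> space noise = Pi\<^sub>E I (\<lambda>p. (\<lambda>x. x + s p) -` A p)"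
    by (auto simp: shift_def space_noise PiE_iff intro: extensional_arb)
  moreover have "Pi\<^sub>E I A \<in> sets noise"
    unfolding sets_noise using fin A by (intro sets_PiM_I_finite) auto
  moreover have "emeasure noise (Pi\<^sub>E I (\<lambda>p. (\<lambda>x. x + s p) -` A p)) =
      (\<Prod>p\<in>I. emeasure (gauss 0 (sqrt (v p))) ((\<lambda>x. x + s p) -` A p))"
    unfolding noise_def
  proof (rule product_sigma_finite.emeasure_PiM[OF product_sigma_finite_gauss fin])
    fix p assume "p \<in> I"
    then show "(\<lambda>x. x + s p) -` A p \<in> sets (gauss 0 (sqrt (v p)))"
      using measurable_sets[of "\<lambda>x. x + s p" borel borel "A p"] by simp
  qed
  moreover have "emeasure (gauss 0 (sqrt (v p))) ((\<lambda>x. x + s p) -` A p) =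
      emeasure (gauss (s p) (sqrt (v p))) (A p)" if "p \<in> I" for p
    using that v_pos[of p] by (subst gauss_shift[symmetric]) (auto simp: emeasure_distr)
  ultimately show "emeasure (distr noise noise (shift s)) (Pi\<^sub>E I A) =
      (\<Prod>p\<in>I. emeasure (gauss (s p) (sqrt (v p))) (A p))"
    by (simp add: emeasure_distr)
qed

lemma density_shift: "density noise (\<lambda>z. ennreal (shift_density s z)) = PiM I (\<lambda>p. gauss (s p) (sqrt (v p)))"
proof (rule product_sigma_finite.PiM_eqI[OF product_sigma_finite_gauss fin])
  show "sets (density noise (\<lambda>z. ennreal (shift_density s z))) = sets (PiM I (\<lambda>p. gauss (s p) (sqrt (v p))))"
    by (simp add: sets_noise) (intro sets_PiM_cong, auto)
  fix A assume A: "\<And>p. p \<in> I \<Longrightarrow> A p \<in> sets (gauss (s p) (sqrt (v p)))"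
  then have [measurable]: "p \<in> I \<Longrightarrow> A p \<in> sets borel" for p by simp
  let ?f = "\<lambda>p x. ennreal (exp (s p * x / (sqrt (v p))\<^sup>2 - (s p)\<^sup>2 / (2 * (sqrt (v p))\<^sup>2)))"
  have "Pi\<^sub>E I A \<in> sets noise"
    unfolding sets_noise using fin A by (intro sets_PiM_I_finite) auto
  then have "emeasure (density noise (\<lambda>z. ennreal (shift_density s z))) (Pi\<^sub>E I A) =
      (\<integral>\<^sup>+z. ennreal (shift_density s z) * indicator (Pi\<^sub>E I A) z \<partial>noise)"
    by (intro emeasure_density) auto
  also have "\<dots> = (\<integral>\<^sup>+z. (\<Prod>p\<in>I. ?f p (z p) * indicator (A p) (z p)) \<partial>noise)"
  proof (rule nn_integral_cong)
    fix z assume z: "z \<in> space noise"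
    have "ennreal (shift_density s z) = (\<Prod>p\<in>I. ?f p (z p))"
      using v_pos by (simp add: shift_density_def exp_sum[OF fin] prod_ennreal less_imp_le)
    moreover have "indicator (Pi\<^sub>E I A) z = (\<Prod>p\<in>I. indicator (A p) (z p) :: ennreal)"
    proof (cases "z \<in> Pi\<^sub>E I A")
      case False
      then obtain p where "p \<in> I" "z p \<notin> A p" using z by (auto simp: space_noise PiE_iff)
      then have "(\<Prod>p\<in>I. indicator (A p) (z p) :: ennreal) = 0"
        using fin by (intro prod_zero bexI[of _ p]) auto
      then show ?thesis using False by simp
    qed (auto simp: PiE_iff)
    ultimately show "ennreal (shift_density s z) * indicator (Pi\<^sub>E I A) z =
        (\<Prod>p\<in>I. ?f p (z p) * indicator (A p) (z p))"
      by (simp add: prod.distrib)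
  qed
  also have "\<dots> = (\<Prod>p\<in>I. \<integral>\<^sup>+x. ?f p x * indicator (A p) x \<partial>gauss 0 (sqrt (v p)))"
    unfolding noise_def
    by (rule product_sigma_finite.product_nn_integral_prod[OF product_sigma_finite_gauss fin]) auto
  also have "\<dots> = (\<Prod>p\<in>I. emeasure (gauss (s p) (sqrt (v p))) (A p))"
  proof (rule prod.cong[OF refl])
    fix p assume p: "p \<in> I"
    then show "(\<integral>\<^sup>+x. ?f p x * indicator (A p) x \<partial>gauss 0 (sqrt (v p))) =
        emeasure (gauss (s p) (sqrt (v p))) (A p)"
      using v_pos[of p] by (subst gauss_tilt[symmetric]) (auto simp: emeasure_density)
  qed
  finally show "emeasure (density noise (\<lambda>z. ennreal (shift_density s z))) (Pi\<^sub>E I A) =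
      (\<Prod>p\<in>I. emeasure (gauss (s p) (sqrt (v p))) (A p))" .
qed

text \<open>Integrating out one coordinate at a time kills the cross terms, as each has mean 0. The
  subset \<open>J\<close> is there for the induction.\<close>

lemma second_moment:
  assumes "J \<subseteq> I"
  shows "(\<integral>\<^sup>+z. ennreal ((a + (\<Sum>p\<in>J. c p * z p))\<^sup>2) \<partial>PiM J (\<lambda>p. gauss 0 (sqrt (v p)))) =
    ennreal (a\<^sup>2 + (\<Sum>p\<in>J. (c p)\<^sup>2 * v p))"
  using finite_subset[OF assms fin]
proof (induction J)
  case empty
  then show ?case by (simp add: PiM_empty)
next
  case (insert i J)
  have "(\<integral>\<^sup>+z. ennreal ((a + (\<Sum>p\<in>insert i J. c p * z p))\<^sup>2) \<partial>PiM (insert i J) (\<lambda>p. gauss 0 (sqrt (v p)))) =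
      (\<integral>\<^sup>+z. (\<integral>\<^sup>+x. ennreal ((a + (\<Sum>p\<in>insert i J. c p * (z(i := x)) p))\<^sup>2) \<partial>gauss 0 (sqrt (v i)))
        \<partial>PiM J (\<lambda>p. gauss 0 (sqrt (v p))))"
    using insert by (intro product_sigma_finite.product_nn_integral_insert product_sigma_finite_gauss) auto
  also have "\<dots> = (\<integral>\<^sup>+z. ennreal ((a + (\<Sum>p\<in>J. c p * z p))\<^sup>2) + ennreal ((c i)\<^sup>2 * v i)
      \<partial>PiM J (\<lambda>p. gauss 0 (sqrt (v p))))"
  proof (rule nn_integral_cong)
    fix z
    have eq: "a + (\<Sum>p\<in>insert i J. c p * (z(i := x)) p) = (a + (\<Sum>p\<in>J. c p * z p)) + c i * x" for x
    proof -
      have "(\<Sum>p\<in>J. c p * (z(i := x)) p) = (\<Sum>p\<in>J. c p * z p)"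
        using insert by (intro sum.cong) auto
      then show ?thesis using insert by simp
    qed
    show "(\<integral>\<^sup>+x. ennreal ((a + (\<Sum>p\<in>insert i J. c p * (z(i := x)) p))\<^sup>2) \<partial>gauss 0 (sqrt (v i))) =
        ennreal ((a + (\<Sum>p\<in>J. c p * z p))\<^sup>2) + ennreal ((c i)\<^sup>2 * v i)"
      unfolding eq using v_pos[of i]
      by (simp add: gauss_second_moment ennreal_plus[symmetric] less_imp_le del: ennreal_plus)
  qed
  also have "\<dots> = (\<integral>\<^sup>+z. ennreal ((a + (\<Sum>p\<in>J. c p * z p))\<^sup>2) \<partial>PiM J (\<lambda>p. gauss 0 (sqrt (v p)))) +
      ennreal ((c i)\<^sup>2 * v i)"
    using prob_space.emeasure_space_1[OF prob_space_PiM[of J "\<lambda>p. gauss 0 (sqrt (v p))"]] prob_gauss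
    by (subst nn_integral_add) auto
  also have "\<dots> = ennreal (a\<^sup>2 + (\<Sum>p\<in>insert i J. (c p)\<^sup>2 * v p))"
    using insert v_pos
    by (simp add: sum_nonneg less_imp_le ennreal_plus[symmetric] algebra_simps del: ennreal_plus)
  finally show ?case .
qed

text \<open>The logarithm of the density is a concave quadratic in \<open>t\<close>, so it lies
  below its tangent at \<open>c\<close>. On the interval of radius \<open>h\<close> the exponential
  of the tangent is at most the sum of its two endpoint values, and there the tangent exceeds the
  quadratic by at most 1/2.\<close>

lemma shift_density_dominated:
  assumes \<tau>: "(\<Sum>p\<in>I. (s p)\<^sup>2 / v p) \<le> \<tau>\<^sup>2" and "h \<ge> 0" "h * \<tau> \<le> 1" "\<tau> \<ge> 0" and "\<bar>t - c\<bar> \<le> h"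
  shows "shift_density (\<lambda>p. t * s p) z
    \<le> 2 * (shift_density (\<lambda>p. (c + h) * s p) z + shift_density (\<lambda>p. (c - h) * s p) z)"
proof -
  define G where "G = (\<Sum>p\<in>I. s p * z p / v p)"
  define T where "T = (\<Sum>p\<in>I. (s p)\<^sup>2 / v p)"
  have sd: "shift_density (\<lambda>p. u * s p) z = exp (u * G - u\<^sup>2 * T / 2)" for u
    by (simp add: shift_density_def G_def T_def sum_subtractf sum_distrib_left sum_divide_distrib
        power_mult_distrib mult_ac)
  have "T \<ge> 0" unfolding T_def using v_pos by (intro sum_nonneg) (auto simp: less_imp_le)
  have hT: "h\<^sup>2 * T / 2 \<le> 1 / 2"
  proof -
    have "h\<^sup>2 * T \<le> h\<^sup>2 * \<tau>\<^sup>2" using \<tau> by (intro mult_left_mono) (auto simp: T_def)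
    also have "\<dots> = (h * \<tau>)\<^sup>2" by (simp add: power_mult_distrib)
    also have "\<dots> \<le> 1" using assms by (intro power_le_one) auto
    finally show ?thesis by simp
  qed
  \<comment> \<open>This is the source of the factor 2:
    \<open>exp 1 \<le> 3 \<le> 4\<close>.\<close>
  have "exp (1 / 2) \<le> (2::real)"
  proof (rule power2_le_imp_le)
    show "(exp (1 / 2))\<^sup>2 \<le> (2::real)\<^sup>2"
      using exp_le by (simp add: exp_double[symmetric])
  qed simp
  have *: "exp (c * G - c\<^sup>2 * T / 2 + w * (G - c * T)) \<le> 2 * exp ((c + w) * G - (c + w)\<^sup>2 * T / 2)"
    if "w\<^sup>2 = h\<^sup>2" for w
  proof -
    have "exp (c * G - c\<^sup>2 * T / 2 + w * (G - c * T)) =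
        exp (h\<^sup>2 * T / 2) * exp ((c + w) * G - (c + w)\<^sup>2 * T / 2)"
      unfolding exp_add[symmetric] that[symmetric] by (simp add: power2_eq_square algebra_simps)
    moreover have "exp (h\<^sup>2 * T / 2) \<le> 2"
      using hT \<open>exp (1 / 2) \<le> 2\<close> by (meson exp_le_cancel_iff order_trans)
    ultimately show ?thesis by (simp add: mult_right_mono)
  qed
  \<comment> \<open>The slope of the tangent at \<open>t = c\<close>.\<close>
  define W where "W = G - c * T"
  have "t * G - t\<^sup>2 * T / 2 \<le> c * G - c\<^sup>2 * T / 2 + (t - c) * W"
  proof -
    have "c * G - c\<^sup>2 * T / 2 + (t - c) * W - (t * G - t\<^sup>2 * T / 2) = (t - c)\<^sup>2 * T / 2"
      by (simp add: W_def power2_eq_square field_simps)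
    moreover have "(t - c)\<^sup>2 * T / 2 \<ge> 0" using \<open>T \<ge> 0\<close> by simp
    ultimately show ?thesis by linarith
  qed
  moreover have "(t - c) * W \<le> h * \<bar>W\<bar>"
  proof -
    have "(t - c) * W \<le> \<bar>t - c\<bar> * \<bar>W\<bar>" by (metis abs_ge_self abs_mult)
    also have "\<dots> \<le> h * \<bar>W\<bar>" using assms(5) by (intro mult_right_mono) auto
    finally show ?thesis .
  qed
  ultimately have "exp (t * G - t\<^sup>2 * T / 2) \<le> exp (c * G - c\<^sup>2 * T / 2 + h * \<bar>W\<bar>)" by simp
  also have "\<dots> \<le> exp (c * G - c\<^sup>2 * T / 2 + h * W) + exp (c * G - c\<^sup>2 * T / 2 + (- h) * W)"
    by (cases "W \<ge> 0") (auto simp: abs_if)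
  also have "\<dots> \<le> 2 * (exp ((c + h) * G - (c + h)\<^sup>2 * T / 2) + exp ((c + (- h)) * G - (c + (- h))\<^sup>2 * T / 2))"
    using *[of h] *[of "- h"] by (simp add: W_def)
  finally show ?thesis by (simp add: sd)
qed

lemma emeasure_shifted_event:
  assumes "D \<in> sets noise"
  shows "emeasure noise {z \<in> space noise. shift s z \<in> D} = (\<integral>\<^sup>+z. ennreal (shift_density s z) * indicator D z \<partial>noise)"
proof -
  have "emeasure noise {z \<in> space noise. shift s z \<in> D} = emeasure (distr noise noise (shift s)) D"
    using assms by (subst emeasure_distr) (auto simp: vimage_def Int_def conj_commute)
  also have "distr noise noise (shift s) = density noise (\<lambda>z. ennreal (shift_density s z))"
    by (simp add: distr_shift density_shift)
  also have "emeasure \<dots> D = (\<integral>\<^sup>+z. ennreal (shift_density s z) * indicator D z \<partial>noise)"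
    using assms by (intro emeasure_density) auto
  finally show ?thesis .
qed

text \<open>All shifts in one cell are controlled by the two shifts at its ends. For a fixed shift,
  disjoint events have total probability at most 1, which is how a whole cell is bounded.\<close>

lemma shifted_event_dominated:
  assumes "(\<Sum>p\<in>I. (s p)\<^sup>2 / v p) \<le> \<tau>\<^sup>2" "h \<ge> 0" "h * \<tau> \<le> 1" "\<tau> \<ge> 0" "\<bar>t - c\<bar> \<le> h"
    and D: "D \<in> sets noise"
  shows "measure noise {z \<in> space noise. shift (\<lambda>p. t * s p) z \<in> D}
    \<le> 2 * (measure noise {z \<in> space noise. shift (\<lambda>p. (c + h) * s p) z \<in> D}
       + measure noise {z \<in> space noise. shift (\<lambda>p. (c - h) * s p) z \<in> D})"
proof -
  interpret prob_space noise by (rule prob_space_noise)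
  let ?f = "\<lambda>t z. ennreal (shift_density (\<lambda>p. t * s p) z)"
  have two: "ennreal (2 * (a + b)) = 2 * (ennreal a + ennreal b)" if "a \<ge> 0" "b \<ge> 0" for a b
    using that by (subst ennreal_mult) (simp_all flip: ennreal_plus)
  have [measurable]: "(\<lambda>z. indicator D z :: ennreal) \<in> borel_measurable noise" using D by simp
  have "(\<integral>\<^sup>+z. ?f t z * indicator D z \<partial>noise)
      \<le> (\<integral>\<^sup>+z. 2 * (?f (c + h) z * indicator D z + ?f (c - h) z * indicator D z) \<partial>noise)"
  proof (rule nn_integral_mono)
    fix z
    have "?f t z \<le> ennreal (2 * (shift_density (\<lambda>p. (c + h) * s p) z + shift_density (\<lambda>p. (c - h) * s p) z))"
      using shift_density_dominated[OF assms(1-5)] by (rule ennreal_leI)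
    also have "\<dots> = 2 * (?f (c + h) z + ?f (c - h) z)"
      by (rule two) (auto simp: shift_density_def)
    finally show "?f t z * indicator D z \<le> 2 * (?f (c + h) z * indicator D z + ?f (c - h) z * indicator D z)"
      by (auto simp: indicator_def)
  qed
  also have "\<dots> = 2 * ((\<integral>\<^sup>+z. ?f (c + h) z * indicator D z \<partial>noise) + (\<integral>\<^sup>+z. ?f (c - h) z * indicator D z \<partial>noise))"
    by (simp add: nn_integral_cmult nn_integral_add)
  finally have "ennreal (measure noise {z \<in> space noise. shift (\<lambda>p. t * s p) z \<in> D})
      \<le> 2 * (ennreal (measure noise {z \<in> space noise. shift (\<lambda>p. (c + h) * s p) z \<in> D})
       + ennreal (measure noise {z \<in> space noise. shift (\<lambda>p. (c - h) * s p) z \<in> D}))"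
    by (simp add: emeasure_shifted_event[OF D, symmetric] emeasure_eq_measure)
  also have "\<dots> = ennreal (2 * (measure noise {z \<in> space noise. shift (\<lambda>p. (c + h) * s p) z \<in> D}
       + measure noise {z \<in> space noise. shift (\<lambda>p. (c - h) * s p) z \<in> D}))"
    by (rule two[symmetric]) auto
  finally show ?thesis by (subst (asm) ennreal_le_iff) auto
qed

end

section \<open>Reliable decoding makes imitating shifts expensive\<close>

context gaussian_noise
begin

text \<open>A shift \<open>s\<close> of the noise that produces the same outputs as the unit message point turns the
  decision regions of different messages into disjoint sets under shifted noise measures.  Message
  points in one cell of length \<open>2 / l\<close> share a total probability of at most 4.\<close>

lemma correct_decoding_bound:
  fixes g :: "(nat \<Rightarrow> real) \<Rightarrow> nat" and \<theta> d :: "nat \<Rightarrow> real" and r :: "nat \<Rightarrow> 'i \<Rightarrow> real"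
  assumes s: "\<And>i. i < n \<Longrightarrow> (\<Sum>p\<in>I. r i p * s p) = d i"
    and \<tau>: "(\<Sum>p\<in>I. (s p)\<^sup>2 / v p) \<le> \<tau>\<^sup>2" "0 \<le> \<tau>" "\<tau> \<le> l" "0 < l"
    and g: "g \<in> measurable (PiM {..<n} (\<lambda>_. borel)) (count_space UNIV)"
    and S: "finite S" "\<And>m. m \<in> S \<Longrightarrow> \<bar>\<theta> m\<bar> \<le> A" "A \<ge> 0"
  shows "(\<Sum>m\<in>S. measure noise {z \<in> space noise.
      g (restrict (\<lambda>i. d i * \<theta> m + (\<Sum>p\<in>I. r i p * z p)) {..<n}) = m}) \<le> 4 * (A * l + 2)"
proof -
  interpret prob_space noise by (rule prob_space_noise)
  define y where "y z = restrict (\<lambda>i. \<Sum>p\<in>I. r i p * z p) {..<n}" for z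
  have y [measurable]: "y \<in> measurable noise (PiM {..<n} (\<lambda>_. borel))"
    unfolding y_def by measurable
  define D where "D m = {z \<in> space noise. g (y z) = m}" for m
  have D [measurable]: "D m \<in> sets noise" for m
  proof -
    have "(\<lambda>z. g (y z)) \<in> measurable noise (count_space UNIV)"
      using measurable_compose[OF y g] .
    then have "(\<lambda>z. g (y z)) -` {m} \<inter> space noise \<in> sets noise" by (rule measurable_sets) simp
    then show ?thesis by (simp add: D_def vimage_def Int_def conj_commute)
  qed
  define E where "E t m = {z \<in> space noise. shift (\<lambda>p. t * s p) z \<in> D m}" for t m
  have E [measurable]: "E t m \<in> sets noise" for t m
  proof -
    have "shift (\<lambda>p. t * s p) -` D m \<inter> space noise \<in> sets noise"
      by (rule measurable_sets[OF measurable_shift D])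
    then show ?thesis by (simp add: E_def vimage_def Int_def conj_commute)
  qed
  \<comment> \<open>Shifting the noise by \<open>\<theta> m * s\<close> adds
    \<open>d i * \<theta> m\<close> to output \<open>i\<close>, just as sending the message point
    \<open>\<theta> m\<close> does.\<close>
  have event: "{z \<in> space noise. g (restrict (\<lambda>i. d i * \<theta> m + (\<Sum>p\<in>I. r i p * z p)) {..<n}) = m} = E (\<theta> m) m" for m
  proof -
    have "y (shift (\<lambda>p. \<theta> m * s p) z) = restrict (\<lambda>i. d i * \<theta> m + (\<Sum>p\<in>I. r i p * z p)) {..<n}" for z
    proof -
      have "(\<Sum>p\<in>I. r i p * (z p + \<theta> m * s p)) = d i * \<theta> m + (\<Sum>p\<in>I. r i p * z p)" if "i < n" for i
        by (simp add: s[OF that, symmetric] sum.distrib sum_distrib_left sum_distrib_right algebra_simps)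
      then show ?thesis by (auto simp: y_def shift_def fun_eq_iff)
    qed
    moreover have "shift u z \<in> space noise" for u z by (simp add: shift_def space_noise)
    ultimately show ?thesis by (auto simp: E_def D_def)
  qed
  have total: "(\<Sum>m\<in>B. prob (E t m)) \<le> 1" if "finite B" for t B
  proof -
    have "disjoint_family_on (E t) B" by (auto simp: disjoint_family_on_def E_def D_def)
    then have "(\<Sum>m\<in>B. prob (E t m)) = prob (\<Union>m\<in>B. E t m)"
      using that by (intro finite_measure_finite_Union[symmetric]) auto
    then show ?thesis by simp
  qed
  \<comment> \<open>The half-length of a cell; \<open>c j\<close> is the midpoint of cell
    \<open>j\<close>.\<close>
  define h where "h = 1 / l"
  define cell where "cell m = \<lfloor>\<theta> m * l / 2\<rfloor>" for m
  define c where "c j = (2 * real_of_int j + 1) / l" for j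
  have near: "\<bar>\<theta> m - c (cell m)\<bar> \<le> h" for m
  proof -
    have "2 * real_of_int (cell m) \<le> \<theta> m * l" "\<theta> m * l \<le> 2 * real_of_int (cell m) + 2"
      unfolding cell_def by linarith+
    then have "\<bar>\<theta> m * l - (2 * real_of_int (cell m) + 1)\<bar> \<le> 1" by linarith
    then have "\<bar>\<theta> m * l - (2 * real_of_int (cell m) + 1)\<bar> / l \<le> 1 / l"
      using \<tau>(4) by (intro divide_right_mono) auto
    moreover have "\<theta> m - c (cell m) = (\<theta> m * l - (2 * real_of_int (cell m) + 1)) / l"
      using \<tau>(4) by (simp add: c_def field_simps)
    ultimately show ?thesis by (simp only: h_def abs_divide abs_of_pos[OF \<tau>(4)])
  qed
  have h: "h \<ge> 0" "h * \<tau> \<le> 1" using \<tau> by (auto simp: h_def)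
  have cell_sum: "(\<Sum>m\<in>{m\<in>S. cell m = j}. prob (E (\<theta> m) m)) \<le> 4" for j
  proof -
    let ?B = "{m\<in>S. cell m = j}"
    have "finite ?B" using S by simp
    have "(\<Sum>m\<in>?B. prob (E (\<theta> m) m)) \<le> (\<Sum>m\<in>?B. 2 * (prob (E (c j + h) m) + prob (E (c j - h) m)))"
      unfolding E_def
    proof (intro sum_mono shifted_event_dominated[OF \<tau>(1) h \<tau>(2) _ D])
      fix m assume "m \<in> ?B"
      then show "\<bar>\<theta> m - c j\<bar> \<le> h" using near[of m] by auto
    qed
    also have "\<dots> = 2 * ((\<Sum>m\<in>?B. prob (E (c j + h) m)) + (\<Sum>m\<in>?B. prob (E (c j - h) m)))"
      by (simp add: sum.distrib sum_distrib_left)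
    also have "\<dots> \<le> 4" using total[OF \<open>finite ?B\<close>, of "c j + h"] total[OF \<open>finite ?B\<close>, of "c j - h"] by simp
    finally show ?thesis .
  qed
  define T where "T = {\<lfloor>- (A * l / 2)\<rfloor>..\<lfloor>A * l / 2\<rfloor>}"
  have "cell m \<in> T" if "m \<in> S" for m
  proof -
    have "- A \<le> \<theta> m" "\<theta> m \<le> A" using S(2)[OF that] by auto
    then have "(- A) * l \<le> \<theta> m * l" "\<theta> m * l \<le> A * l" using \<tau>(4) by (intro mult_right_mono; simp)+
    then show ?thesis unfolding T_def cell_def by (auto intro!: floor_mono)
  qed
  then have "(\<Sum>m\<in>S. prob (E (\<theta> m) m)) = (\<Sum>j\<in>T. \<Sum>m\<in>{m\<in>S. cell m = j}. prob (E (\<theta> m) m))"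
    using S(1) by (intro sum.group[symmetric]) (auto simp: T_def)
  also have "\<dots> \<le> (\<Sum>j\<in>T. 4)" by (intro sum_mono cell_sum)
  also have "\<dots> = 4 * real (card T)" by simp
  \<comment> \<open>The number of cells that meet \<open>[-A, A]\<close>, with 2 for rounding at the
    ends.\<close>
  also have "real (card T) \<le> A * l + 2"
  proof -
    have "A * l / 2 \<ge> 0" using S(3) \<tau>(4) by simp
    then have "real (card T) = real_of_int (\<lfloor>A * l / 2\<rfloor> - \<lfloor>- (A * l / 2)\<rfloor> + 1)"
      unfolding T_def card_atLeastAtMost_int by (subst of_nat_nat) linarith+
    then show ?thesis by linarith
  qed
  finally show ?thesis by (simp add: event)
qed

text \<open>With a cheaper shift, the messages with \<open>\<bar>\<theta> m\<bar> \<le> A\<close>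
  would contribute at most \<open>L / 4 + 8\<close> to the sum of correct probabilities, and the
  others at most \<open>L / 4\<close>. For \<open>L > 32\<close> this stays below
  \<open>3 / 4 * L\<close>.\<close>

theorem shift_energy_lower_bound:
  fixes g :: "(nat \<Rightarrow> real) \<Rightarrow> nat" and \<theta> d :: "nat \<Rightarrow> real" and r :: "nat \<Rightarrow> 'i \<Rightarrow> real"
  assumes s: "\<And>i. i < n \<Longrightarrow> (\<Sum>p\<in>I. r i p * s p) = d i"
    and g: "g \<in> measurable (PiM {..<n} (\<lambda>_. borel)) (count_space UNIV)"
    and L: "L > 32" and A: "A > 0" "4 * (\<Sum>m\<in>{1..L}. (\<theta> m)\<^sup>2) \<le> real L * A\<^sup>2"
    and correct: "(\<Sum>m\<in>{1..L}. measure noise {z \<in> space noise.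
      g (restrict (\<lambda>i. d i * \<theta> m + (\<Sum>p\<in>I. r i p * z p)) {..<n}) = m}) \<ge> 3 / 4 * real L"
  shows "real L / (16 * A) \<le> sqrt (\<Sum>p\<in>I. (s p)\<^sup>2 / v p)"
proof (rule ccontr)
  interpret prob_space noise by (rule prob_space_noise)
  let ?pr = "\<lambda>m. prob {z \<in> space noise. g (restrict (\<lambda>i. d i * \<theta> m + (\<Sum>p\<in>I. r i p * z p)) {..<n}) = m}"
  define T where "T = (\<Sum>p\<in>I. (s p)\<^sup>2 / v p)"
  assume "\<not> real L / (16 * A) \<le> sqrt (\<Sum>p\<in>I. (s p)\<^sup>2 / v p)"
  then have lt: "sqrt T < real L / (16 * A)" by (simp add: T_def)
  have "T \<ge> 0" unfolding T_def using v_pos by (intro sum_nonneg) (auto simp: less_imp_le)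
  define S where "S = {m\<in>{1..L}. \<bar>\<theta> m\<bar> \<le> A}"
  define B where "B = {m\<in>{1..L}. \<not> \<bar>\<theta> m\<bar> \<le> A}"
  have "(\<Sum>m\<in>S. ?pr m) \<le> 4 * (A * (real L / (16 * A)) + 2)"
    using s g lt A L \<open>T \<ge> 0\<close>
    by (intro correct_decoding_bound[where \<tau> = "sqrt T"]) (auto simp: S_def T_def)
  then have 1: "(\<Sum>m\<in>S. ?pr m) \<le> real L / 4 + 8" using A by simp
  \<comment> \<open>Markov's inequality: at most a quarter of the message points exceed
    \<open>A\<close> in absolute value.\<close>
  have "real (card B) * A\<^sup>2 = (\<Sum>m\<in>B. A\<^sup>2)" by simp
  also have "\<dots> \<le> (\<Sum>m\<in>B. (\<theta> m)\<^sup>2)"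
  proof (rule sum_mono)
    fix m assume "m \<in> B"
    then have "A\<^sup>2 \<le> \<bar>\<theta> m\<bar>\<^sup>2" using A by (intro power_mono) (auto simp: B_def)
    then show "A\<^sup>2 \<le> (\<theta> m)\<^sup>2" by simp
  qed
  also have "\<dots> \<le> (\<Sum>m\<in>{1..L}. (\<theta> m)\<^sup>2)" by (intro sum_mono2) (auto simp: B_def)
  finally have "real (card B) * A\<^sup>2 \<le> (real L / 4) * A\<^sup>2" using A(2) by simp
  then have "real (card B) \<le> real L / 4" using A by simp
  moreover have "(\<Sum>m\<in>B. ?pr m) \<le> real (card B)"
    using sum_mono[of B ?pr "\<lambda>_. 1"] by simp
  moreover have "(\<Sum>m\<in>{1..L}. ?pr m) = (\<Sum>m\<in>S. ?pr m) + (\<Sum>m\<in>B. ?pr m)"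
    unfolding S_def B_def by (subst sum.union_disjoint[symmetric]) (auto intro!: sum.cong)
  ultimately have "3 / 4 * real L \<le> real L / 4 + 8 + real L / 4" using 1 correct by linarith
  then show False using L by simp
qed

end

section \<open>Linear feedback schemes\<close>

lemma length_lin_inputs_list [simp]: "length (lin_inputs_list K a b \<theta> z i) = i"
  by (induction i) (auto simp: Let_def)

lemma nth_lin_inputs_list: "j < i \<Longrightarrow> lin_inputs_list K a b \<theta> z i ! j = lin_X K a b \<theta> z j"
proof (induction i)
  case (Suc i)
  show ?case
  proof (cases "j = i")
    case False
    then have "j < i" using Suc by simp
    then show ?thesis using Suc.IH by (simp add: Let_def nth_append)
  qed (simp add: lin_X_def)
qed simp

lemma lin_X_rec:
  "lin_X K a b \<theta> z i = a i * \<theta> + (\<Sum>k\<in>{1..K}. \<Sum>j<i. b i k j * (lin_X K a b \<theta> z j + z (k, j)))"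
  by (subst lin_X_def) (simp add: Let_def nth_append nth_lin_inputs_list)

text \<open>The coefficients are quantified before \<open>\<theta>\<close> and \<open>z\<close>, so
  one choice serves all messages and noise values; stopping at \<open>i\<close> records
  causality.\<close>

definition affine_in_past :: "nat \<Rightarrow> nat \<Rightarrow> (real \<Rightarrow> (nat \<times> nat \<Rightarrow> real) \<Rightarrow> real) \<Rightarrow> bool" where
  "affine_in_past K i f \<longleftrightarrow> (\<exists>d c. \<forall>\<theta> z. f \<theta> z = d * \<theta> + (\<Sum>p\<in>{1..K} \<times> {..<i}. c p * z p))"

lemma affine_in_past_point: "affine_in_past K i (\<lambda>\<theta> z. a * \<theta>)"
  unfolding affine_in_past_def by (intro exI[of _ a] exI[of _ "\<lambda>_. 0"]) simp

lemma affine_in_past_noise: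
  assumes "q \<in> {1..K} \<times> {..<i}"
  shows "affine_in_past K i (\<lambda>\<theta> z. z q)"
proof -
  have "(\<Sum>p\<in>{1..K} \<times> {..<i}. (if p = q then 1 else 0) * z p) = z q" for z :: "nat \<times> nat \<Rightarrow> real"
  proof -
    have "(\<Sum>p\<in>{1..K} \<times> {..<i}. (if p = q then 1 else 0) * z p) = (\<Sum>p\<in>{1..K} \<times> {..<i}. if p = q then z p else 0)"
      by (intro sum.cong) auto
    then show ?thesis using assms by simp
  qed
  then show ?thesis unfolding affine_in_past_def
    by (intro exI[of _ 0] exI[of _ "\<lambda>p. if p = q then 1 else 0"]) simp
qed

lemma affine_in_past_add:
  assumes "affine_in_past K i f" "affine_in_past K i g"
  shows "affine_in_past K i (\<lambda>\<theta> z. f \<theta> z + g \<theta> z)"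
proof -
  obtain d c d' c' where "\<forall>\<theta> z. f \<theta> z = d * \<theta> + (\<Sum>p\<in>{1..K} \<times> {..<i}. c p * z p)"
    "\<forall>\<theta> z. g \<theta> z = d' * \<theta> + (\<Sum>p\<in>{1..K} \<times> {..<i}. c' p * z p)"
    using assms unfolding affine_in_past_def by blast
  then show ?thesis unfolding affine_in_past_def
    by (intro exI[of _ "d + d'"] exI[of _ "\<lambda>p. c p + c' p"]) (simp add: algebra_simps sum.distrib)
qed

lemma affine_in_past_scale:
  assumes "affine_in_past K i f"
  shows "affine_in_past K i (\<lambda>\<theta> z. x * f \<theta> z)"
proof -
  obtain d c where "\<forall>\<theta> z. f \<theta> z = d * \<theta> + (\<Sum>p\<in>{1..K} \<times> {..<i}. c p * z p)"
    using assms unfolding affine_in_past_def by blast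
  then show ?thesis unfolding affine_in_past_def
    by (intro exI[of _ "x * d"] exI[of _ "\<lambda>p. x * c p"]) (simp add: algebra_simps sum_distrib_left)
qed

lemma affine_in_past_sum:
  assumes "\<And>x. x \<in> J \<Longrightarrow> affine_in_past K i (f x)"
  shows "affine_in_past K i (\<lambda>\<theta> z. \<Sum>x\<in>J. f x \<theta> z)"
proof -
  have 0: "affine_in_past K i (\<lambda>\<theta> z. 0)" using affine_in_past_point[of K i 0] by simp
  show ?thesis
    using assms by (induction J rule: infinite_finite_induct) (simp_all add: 0 affine_in_past_add)
qed

lemma affine_in_past_mono:
  assumes "affine_in_past K j f" "j \<le> i"
  shows "affine_in_past K i f"
proof -
  obtain d c where f: "\<And>\<theta> z. f \<theta> z = d * \<theta> + (\<Sum>p\<in>{1..K} \<times> {..<j}. c p * z p)"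
    using assms unfolding affine_in_past_def by blast
  have "affine_in_past K i (\<lambda>\<theta> z. d * \<theta> + (\<Sum>p\<in>{1..K} \<times> {..<j}. c p * z p))"
    using assms(2)
    by (intro affine_in_past_add affine_in_past_point affine_in_past_sum affine_in_past_scale affine_in_past_noise) auto
  then show ?thesis unfolding f[symmetric] .
qed

lemma affine_in_past_lin_X: "affine_in_past K i (\<lambda>\<theta> z. lin_X K a b \<theta> z i)"
proof (induction i rule: less_induct)
  case (less i)
  have "affine_in_past K i (\<lambda>\<theta> z. a i * \<theta> + (\<Sum>k\<in>{1..K}. \<Sum>j<i. b i k j * (lin_X K a b \<theta> z j + z (k, j))))"
    by (intro affine_in_past_add affine_in_past_point affine_in_past_sum affine_in_past_scale affine_in_past_noise)
      (auto intro: affine_in_past_mono[OF less])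
  then show ?case by (subst lin_X_rec)
qed

lemma lin_X_affine:
  obtains d c where "\<And>\<theta> z i. lin_X K a b \<theta> z i = d i * \<theta> + (\<Sum>p\<in>{1..K} \<times> {..<i}. c i p * z p)"
  using affine_in_past_lin_X unfolding affine_in_past_def by metis

text \<open>Duality turns the energy bound into a combination \<open>w\<close> with message
  coefficient 1 and norm at most \<open>16 * A / L\<close>. Dividing by \<open>w i\<close> at a slot
  that carries at least \<open>1 / n\<close> of this coefficient costs a factor
  \<open>n * \<bar>d i\<bar>\<close>, and the power bound controls
  \<open>A * \<bar>d i\<bar>\<close>.\<close>

lemma (in gaussian_noise) receiver_combination:
  fixes g :: "(nat \<Rightarrow> real) \<Rightarrow> nat" and \<theta> d :: "nat \<Rightarrow> real" and r :: "nat \<Rightarrow> 'i \<Rightarrow> real"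
    and e :: "'i \<Rightarrow> 'a::real_inner"
  assumes e: "\<And>p q. p \<in> I \<Longrightarrow> q \<in> I \<Longrightarrow> e p \<bullet> e q = (if p = q then v p else 0)"
    and g: "g \<in> measurable (PiM {..<n} (\<lambda>_. borel)) (count_space UNIV)"
    and L: "L > 32" and P: "P \<ge> 0"
    and power: "\<And>i. i < n \<Longrightarrow> (d i)\<^sup>2 * (\<Sum>m\<in>{1..L}. (\<theta> m)\<^sup>2) \<le> real n * real L * P"
    and correct: "(\<Sum>m\<in>{1..L}. measure noise {z \<in> space noise.
      g (restrict (\<lambda>i. d i * \<theta> m + (\<Sum>p\<in>I. r i p * z p)) {..<n}) = m}) \<ge> 3 / 4 * real L"
  obtains i u where "i < n" "u i = 1"
    "norm (\<Sum>j<n. u j *\<^sub>R (\<Sum>p\<in>I. r j p *\<^sub>R e p)) \<le> 16 * real n * sqrt (4 * real n * P + 1) / real L"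
proof -
  define R where "R j = (\<Sum>p\<in>I. r j p *\<^sub>R e p)" for j
  define D where "D = 1 + (\<Sum>i<n. (d i)\<^sup>2)"
  define Q where "Q = (\<Sum>m\<in>{1..L}. (\<theta> m)\<^sup>2) / real L"
  \<comment> \<open>The term \<open>4 * Q\<close> is what the second-moment condition asks for.
    Adding \<open>1 / D\<close> keeps \<open>A\<close> positive when all message points vanish, and
    contributes at most 1 to \<open>(A * \<bar>d i\<bar>)\<^sup>2\<close> because
    \<open>(d i)\<^sup>2 \<le> D\<close>.\<close>
  define A where "A = sqrt (4 * Q + 1 / D)"
  have D: "D \<ge> 1" by (simp add: D_def sum_nonneg)
  have Q: "Q \<ge> 0" by (simp add: Q_def sum_nonneg)
  have A2: "A\<^sup>2 = 4 * Q + 1 / D" using D Q by (simp add: A_def)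
  have A: "A > 0" using D Q by (simp add: A_def add_nonneg_pos)
  have LQ: "(\<Sum>m\<in>{1..L}. (\<theta> m)\<^sup>2) = real L * Q" using L by (simp add: Q_def)
  define t where "t = real L / (16 * A)"
  have t: "t > 0" using L A by (simp add: t_def)
  have bound: "t \<le> norm s" if s: "\<And>j. j \<in> {..<n} \<Longrightarrow> R j \<bullet> s = d j" for s
  proof -
    define c where "c p = s \<bullet> e p" for p
    define q where "q = (\<Sum>p\<in>I. (c p / v p) *\<^sub>R e p)"
    have vp: "v p \<noteq> 0" for p using v_pos[of p] by simp
    have "t \<le> sqrt (\<Sum>p\<in>I. (c p)\<^sup>2 / v p)"
      unfolding t_def
    proof (rule shift_energy_lower_bound[OF _ g L A _ correct])
      fix i assume "i < n"
      then show "(\<Sum>p\<in>I. r i p * c p) = d i"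
        using s[of i] by (simp add: R_def inner_sum_left c_def inner_commute[of s])
    next
      show "4 * (\<Sum>m\<in>{1..L}. (\<theta> m)\<^sup>2) \<le> real L * A\<^sup>2"
        unfolding LQ A2 using D by (simp add: algebra_simps)
    qed
    \<comment> \<open>Bessel's inequality, with \<open>q\<close> the projection of \<open>s\<close>
      onto the span of the noises.\<close>
    also have "(\<Sum>p\<in>I. (c p)\<^sup>2 / v p) \<le> (norm s)\<^sup>2"
    proof -
      have eq: "e p \<bullet> q = c p" if "p \<in> I" for p
      proof -
        have "e p \<bullet> q = (\<Sum>i\<in>I. if i = p then c p else 0)"
          unfolding q_def inner_sum_right using e[OF that] vp by (intro sum.cong) auto
        then show ?thesis using fin that by simp
      qed
      have sq: "s \<bullet> q = (\<Sum>p\<in>I. (c p)\<^sup>2 / v p)"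
        by (simp add: q_def inner_sum_right c_def[symmetric] power2_eq_square)
      have qq: "q \<bullet> q = (\<Sum>p\<in>I. (c p)\<^sup>2 / v p)"
        using eq by (subst (1) q_def) (simp add: inner_sum_left power2_eq_square)
      have "0 \<le> (s - q) \<bullet> (s - q)" by simp
      also have "\<dots> = (norm s)\<^sup>2 - (\<Sum>p\<in>I. (c p)\<^sup>2 / v p)"
        using sq qq by (simp add: inner_diff_left inner_diff_right inner_commute[of q s] power2_norm_eq_inner)
      finally show ?thesis by simp
    qed
    finally show ?thesis by (simp add: real_le_rsqrt)
  qed
  obtain w where w: "(\<Sum>j<n. w j * d j) = 1" "norm (\<Sum>j<n. w j *\<^sub>R R j) \<le> 1 / t"
    using dual_combination[of "{..<n}" t R d] bound t by blast
  have "n > 0" using w(1) by (cases n) auto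
  have "\<exists>i<n. 1 / real n \<le> \<bar>w i * d i\<bar>"
  proof (rule ccontr)
    assume "\<not> (\<exists>i<n. 1 / real n \<le> \<bar>w i * d i\<bar>)"
    then have "(\<Sum>j<n. w j * d j) < (\<Sum>j<n. 1 / real n)"
      using \<open>n > 0\<close> by (intro sum_strict_mono) (auto simp: not_le intro: le_less_trans[OF abs_ge_self])
    then show False using w(1) \<open>n > 0\<close> by simp
  qed
  then obtain i where i: "i < n" "1 / real n \<le> \<bar>w i * d i\<bar>" by blast
  have wi: "w i \<noteq> 0" "d i \<noteq> 0" using i(2) \<open>n > 0\<close> by auto
  define u where "u j = w j / w i" for j
  have Ad: "A * \<bar>d i\<bar> \<le> sqrt (4 * real n * P + 1)"
  proof (rule real_le_rsqrt)
    have "(d i)\<^sup>2 * (real L * Q) \<le> real n * real L * P" using power[OF i(1)] unfolding LQ .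
    then have "real L * ((d i)\<^sup>2 * Q) \<le> real L * (real n * P)" by (simp add: mult_ac)
    then have 1: "(d i)\<^sup>2 * Q \<le> real n * P" using L by simp
    have "(d i)\<^sup>2 \<le> (\<Sum>i<n. (d i)\<^sup>2)" using i(1) by (intro member_le_sum) auto
    then have 2: "(d i)\<^sup>2 / D \<le> 1" using D by (simp add: D_def)
    have "(A * \<bar>d i\<bar>)\<^sup>2 = 4 * ((d i)\<^sup>2 * Q) + (d i)\<^sup>2 / D"
      by (simp add: power_mult_distrib A2 algebra_simps)
    then show "(A * \<bar>d i\<bar>)\<^sup>2 \<le> 4 * real n * P + 1" using 1 2 by linarith
  qed
  have "1 / \<bar>w i\<bar> \<le> real n * \<bar>d i\<bar>"
    using i(2) wi \<open>n > 0\<close> by (simp add: abs_mult field_simps)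
  have "(\<Sum>j<n. u j *\<^sub>R R j) = (1 / w i) *\<^sub>R (\<Sum>j<n. w j *\<^sub>R R j)"
    by (simp add: u_def scaleR_sum_right)
  then have "norm (\<Sum>j<n. u j *\<^sub>R R j) = (1 / \<bar>w i\<bar>) * norm (\<Sum>j<n. w j *\<^sub>R R j)" by simp
  also have "\<dots> \<le> (real n * \<bar>d i\<bar>) * (1 / t)"
    using w(2) \<open>1 / \<bar>w i\<bar> \<le> real n * \<bar>d i\<bar>\<close> by (intro mult_mono) auto
  also have "\<dots> = 16 * real n * (A * \<bar>d i\<bar>) / real L" by (simp add: t_def)
  also have "\<dots> \<le> 16 * real n * sqrt (4 * real n * P + 1) / real L"
    using Ad by (intro divide_right_mono mult_left_mono) auto
  finally show ?thesis using i(1) wi by (intro that[of i u]) (auto simp: u_def R_def)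
qed

text \<open>The value 1 at indices that do not occur keeps every variance positive, which the product
  measure lemmas require for all indices.\<close>

definition noise_var :: "nat \<Rightarrow> (nat \<Rightarrow> real) \<Rightarrow> nat \<times> nat \<Rightarrow> real" where
  "noise_var K sig2 p = (if fst p \<in> {1..K} then sig2 (fst p) else 1)"

lemma gaussian_noise_noise_var:
  assumes "\<forall>k\<in>{1..K}. sig2 k > 0"
  shows "gaussian_noise ({1..K} \<times> {..<n}) (noise_var K sig2)"
  using assms by unfold_locales (auto simp: noise_var_def)

lemma noise_space_eq:
  assumes "\<forall>k\<in>{1..K}. sig2 k > 0"
  shows "noise_space K sig2 n = gaussian_noise.noise ({1..K} \<times> {..<n}) (noise_var K sig2)"
  unfolding noise_space_def gaussian_noise.noise_def[OF gaussian_noise_noise_var[OF assms]]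
  by (intro PiM_cong) (auto simp: noise_var_def)

text \<open>The noise is centered, so in the second moment of each input the message part and the
  noise part simply add.\<close>

lemma lin_power_bound:
  assumes sig: "\<forall>k\<in>{1..K}. sig2 k > 0" and "n > 0" "L > 0" "P \<ge> 0"
    and X: "\<And>\<theta> z i. i < n \<Longrightarrow> lin_X K a b \<theta> z i = d i * \<theta> + (\<Sum>p\<in>{1..K} \<times> {..<n}. c i p * z p)"
    and power: "lin_power K sig2 n L a b \<theta> \<le> ennreal P"
  shows "(\<Sum>m\<in>{1..L}. \<Sum>i<n. (d i)\<^sup>2 * (\<theta> m)\<^sup>2 + (\<Sum>p\<in>{1..K} \<times> {..<n}. (c i p)\<^sup>2 * noise_var K sig2 p))
    \<le> real n * real L * P"
proof -
  let ?I = "{1..K} \<times> {..<n}"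
  interpret gaussian_noise ?I "noise_var K sig2" by (rule gaussian_noise_noise_var[OF sig])
  let ?e = "\<lambda>m i. (d i)\<^sup>2 * (\<theta> m)\<^sup>2 + (\<Sum>p\<in>?I. (c i p)\<^sup>2 * noise_var K sig2 p)"
  have nonneg: "?e m i \<ge> 0" for m i
    using v_pos by (intro add_nonneg_nonneg sum_nonneg mult_nonneg_nonneg) (auto simp: less_imp_le)
  have [measurable]: "(\<lambda>z. z p) \<in> borel_measurable noise" if "p \<in> ?I" for p
    unfolding noise_def using that by measurable
  have "(\<integral>\<^sup>+z. ennreal (\<Sum>i<n. (lin_X K a b (\<theta> m) z i)\<^sup>2) \<partial>noise_space K sig2 n) = ennreal (\<Sum>i<n. ?e m i)" for m
  proof -
    have "(\<integral>\<^sup>+z. ennreal (\<Sum>i<n. (lin_X K a b (\<theta> m) z i)\<^sup>2) \<partial>noise_space K sig2 n) =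
        (\<integral>\<^sup>+z. (\<Sum>i<n. ennreal ((d i * \<theta> m + (\<Sum>p\<in>?I. c i p * z p))\<^sup>2)) \<partial>noise)"
      unfolding noise_space_eq[OF sig] by (intro nn_integral_cong) (simp add: X sum_ennreal)
    also have "\<dots> = (\<Sum>i<n. \<integral>\<^sup>+z. ennreal ((d i * \<theta> m + (\<Sum>p\<in>?I. c i p * z p))\<^sup>2) \<partial>noise)"
      by (intro nn_integral_sum) measurable
    also have "\<dots> = (\<Sum>i<n. ennreal (?e m i))"
      unfolding noise_def by (subst second_moment) (auto simp: power_mult_distrib)
    also have "\<dots> = ennreal (\<Sum>i<n. ?e m i)" using nonneg by (intro sum_ennreal)
    finally show ?thesis .
  qed
  then have "lin_power K sig2 n L a b \<theta> = ennreal (1 / (real n * real L)) * (\<Sum>m\<in>{1..L}. ennreal (\<Sum>i<n. ?e m i))"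
    by (simp add: lin_power_def)
  also have "\<dots> = ennreal (1 / (real n * real L)) * ennreal (\<Sum>m\<in>{1..L}. \<Sum>i<n. ?e m i)"
    using nonneg by (subst sum_ennreal) (auto intro!: sum_nonneg)
  also have "\<dots> = ennreal ((1 / (real n * real L)) * (\<Sum>m\<in>{1..L}. \<Sum>i<n. ?e m i))"
    using nonneg by (intro ennreal_mult[symmetric]) (auto intro!: sum_nonneg)
  finally have "(1 / (real n * real L)) * (\<Sum>m\<in>{1..L}. \<Sum>i<n. ?e m i) \<le> P"
    using power assms(4) by (simp add: ennreal_le_iff)
  then show ?thesis using assms(2,3) by (simp add: field_simps)
qed

text \<open>A wrong decision of receiver \<open>k\<close> is part of the union error event, so its
  average probability is below 1/4.\<close>

lemma lin_error_bound:
  assumes sig: "\<forall>k\<in>{1..K}. sig2 k > 0" and "L > 0" and k: "k \<in> {1..K}"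
    and X: "\<And>\<theta> z i. i < n \<Longrightarrow> lin_X K a b \<theta> z i = d i * \<theta> + (\<Sum>p\<in>{1..K} \<times> {..<n}. c i p * z p)"
    and g: "\<forall>k\<in>{1..K}. g k \<in> measurable (PiM {..<n} (\<lambda>_. borel)) (count_space UNIV)"
    and err: "lin_error K sig2 n L a b \<theta> g < 1 / 4"
  defines "M \<equiv> gaussian_noise.noise ({1..K} \<times> {..<n}) (noise_var K sig2)"
  shows "(\<Sum>m\<in>{1..L}. measure M {z \<in> space M. g k (restrict (\<lambda>i. d i * \<theta> m +
      (\<Sum>p\<in>{1..K} \<times> {..<n}. (c i p + (if p = (k, i) then 1 else 0)) * z p)) {..<n}) = m}) \<ge> 3 / 4 * real L"
proof -
  let ?I = "{1..K} \<times> {..<n}"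
  interpret gaussian_noise ?I "noise_var K sig2" by (rule gaussian_noise_noise_var[OF sig])
  interpret prob_space noise by (rule prob_space_noise)
  let ?y = "\<lambda>m l z. restrict (\<lambda>i. d i * \<theta> m + (\<Sum>p\<in>?I. (c i p + (if p = (l, i) then 1 else 0)) * z p)) {..<n}"
  have Y: "restrict (\<lambda>i. lin_Y K a b (\<theta> m) z l i) {..<n} = ?y m l z" if l: "l \<in> {1..K}" for m l z
  proof -
    have "(\<Sum>p\<in>?I. (if p = (l, i) then 1 else 0) * z p) = z (l, i)" if "i < n" for i
    proof -
      have "(\<Sum>p\<in>?I. (if p = (l, i) then 1 else 0) * z p) = (\<Sum>p\<in>?I. if p = (l, i) then z p else 0)"
        by (intro sum.cong) auto
      then show ?thesis using l that by simp
    qed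
    then show ?thesis by (auto simp: lin_Y_def X fun_eq_iff distrib_right sum.distrib)
  qed
  define C where "C m l = {z \<in> space noise. g l (?y m l z) = m}" for m l
  have C: "C m l \<in> events" if l: "l \<in> {1..K}" for m l
  proof -
    have "?y m l \<in> measurable noise (PiM {..<n} (\<lambda>_. borel))" by measurable
    then have "(\<lambda>z. g l (?y m l z)) \<in> measurable noise (count_space UNIV)"
      using measurable_compose g l by blast
    then have "(\<lambda>z. g l (?y m l z)) -` {m} \<inter> space noise \<in> events" by (rule measurable_sets) simp
    then show ?thesis by (simp add: C_def vimage_def Int_def conj_commute)
  qed
  define F where "F m = {z \<in> space noise. \<exists>l\<in>{1..K}. g l (restrict (\<lambda>i. lin_Y K a b (\<theta> m) z l i) {..<n}) \<noteq> m}" for m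
  \<comment> \<open>Writing the error event as a finite union of measurable sets makes it
    measurable, which monotonicity of the measure requires.\<close>
  have F: "F m = (\<Union>l\<in>{1..K}. space noise - C m l)" for m
    using Y by (auto simp: F_def C_def)
  have "1 - prob (C m k) \<le> prob (F m)" for m
  proof -
    have "1 - prob (C m k) = prob (space noise - C m k)" by (rule prob_compl[OF C[OF k], symmetric])
    also have "\<dots> \<le> prob (F m)"
      unfolding F using C k by (intro finite_measure_mono) (auto intro!: sets.finite_UN)
    finally show ?thesis .
  qed
  then have "(\<Sum>m\<in>{1..L}. 1 - prob (C m k)) \<le> (\<Sum>m\<in>{1..L}. prob (F m))" by (rule sum_mono)
  also have "(\<Sum>m\<in>{1..L}. prob (F m)) < real L / 4"
    using err assms(2) unfolding lin_error_def noise_space_eq[OF sig] F_def by (simp add: field_simps)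
  finally have "(\<Sum>m\<in>{1..L}. prob (C m k)) \<ge> 3 / 4 * real L" by (simp add: sum_subtractf)
  then show ?thesis by (simp add: C_def M_def)
qed

section \<open>Private messages carved out of the noise\<close>

text \<open>Reducing the noise by at most half does not raise the numerator, and leaves at least
  half of the denominator.\<close>

lemma ln_gain_halved_noise:
  fixes a b M N :: real
  assumes "a \<ge> 0" "b \<ge> 0" "N > 0" "N / 2 \<le> M" "M \<le> N"
  shows "ln ((a + M) / (b + M)) \<le> ln ((a + N) / (b + N)) + ln 2"
proof -
  have pos: "a + M > 0" "b + M > 0" "a + N > 0" "b + N > 0" using assms by auto
  have "(a + M) / (b + M) \<le> (a + N) / ((b + N) / 2)"
    using assms pos by (intro frac_le) auto
  also have "\<dots> = (a + N) / (b + N) * 2" by simp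
  finally have "ln ((a + M) / (b + M)) \<le> ln ((a + N) / (b + N) * 2)"
    using pos by (intro ln_mono) auto
  also have "\<dots> = ln ((a + N) / (b + N)) + ln 2" using pos by (intro ln_mult_pos) auto
  finally show ?thesis .
qed

context degraded_observations
begin

text \<open>\<open>s l\<close> is the full noise variance; at time \<open>\<tau> l\<close> half of it is used by the message.\<close>

lemma converse_ln_reduced_noise:
  assumes k: "k \<in> {1..K}" and p: "p \<in> span (obs k n)" "norm (m k + p) \<le> d" and "m k \<noteq> 0" "d > 0"
    and s: "\<And>l. l \<in> {1..K} \<Longrightarrow> s l > 0"
    and z: "\<And>l j. l \<in> {1..K} \<Longrightarrow> (norm (z l j))\<^sup>2 = (if j = \<tau> l then s l / 2 else s l)"
  shows "ln ((norm (m k))\<^sup>2 / d\<^sup>2) \<le>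
    (\<Sum>j<n. ln ((residual (k - 1) j + N_eff s k) / (residual k j + N_eff s k))) + real K * ln 2"
proof -
  have sub: "l \<in> {1..K}" if "l \<in> {1..k}" for l using that k by auto
  define S where "S = (\<Sum>l\<in>{1..k}. inverse (s l))"
  have S: "S > 0" unfolding S_def using k s sub by (intro sum_pos) auto
  have N: "N_eff s k > 0" using S by (simp add: N_eff_def S_def)
  let ?J = "\<lambda>j. \<Sum>l\<in>{1..k}. inverse ((norm (z l j))\<^sup>2)"
  \<comment> \<open>The at most \<open>K\<close> slots in which some receiver's noise is halved;
    each costs at most \<open>ln 2\<close>.\<close>
  let ?B = "\<tau> ` {1..K}"
  have step: "ln ((residual (k - 1) j + joint_noise k j) / (residual k j + joint_noise k j))
      \<le> ln ((residual (k - 1) j + N_eff s k) / (residual k j + N_eff s k)) + (if j \<in> ?B then ln 2 else 0)" for j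
  proof (cases "j \<in> ?B")
    case True
    have "S \<le> ?J j"
      unfolding S_def using s sub by (intro sum_mono) (auto simp: z le_imp_inverse_le)
    moreover have "?J j \<le> 2 * S"
      unfolding S_def sum_distrib_left
    proof (rule sum_mono)
      fix l assume "l \<in> {1..k}"
      then have "l \<in> {1..K}" by (rule sub)
      then show "inverse ((norm (z l j))\<^sup>2) \<le> 2 * inverse (s l)"
        using s[of l] by (simp add: z divide_simps)
    qed
    ultimately have "N_eff s k / 2 \<le> joint_noise k j" "joint_noise k j \<le> N_eff s k"
      using S unfolding N_eff_def joint_noise_def S_def[symmetric]
      by (auto simp: field_simps)
    then show ?thesis using True ln_gain_halved_noise[OF residual_nonneg residual_nonneg N] by simp
  next
    case False
    have "?J j = S"
      unfolding S_def
    proof (rule sum.cong[OF refl])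
      fix l assume "l \<in> {1..k}"
      then show "inverse ((norm (z l j))\<^sup>2) = inverse (s l)" using False sub[of l] by (auto simp: z)
    qed
    then show ?thesis using False by (simp add: N_eff_def joint_noise_def S_def)
  qed
  have "ln ((norm (m k))\<^sup>2 / d\<^sup>2)
    \<le> (\<Sum>j<n. ln ((residual (k - 1) j + joint_noise k j) / (residual k j + joint_noise k j)))"
    using assms(1-5) by (rule converse_ln)
  also have "\<dots> \<le> (\<Sum>j<n. ln ((residual (k - 1) j + N_eff s k) / (residual k j + N_eff s k)) + (if j \<in> ?B then ln 2 else 0))"
    by (intro sum_mono step)
  also have "\<dots> = (\<Sum>j<n. ln ((residual (k - 1) j + N_eff s k) / (residual k j + N_eff s k))) + (\<Sum>j<n. if j \<in> ?B then ln 2 else 0)"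
    by (rule sum.distrib)
  also have "(\<Sum>j<n. if j \<in> ?B then ln 2 else 0) = real (card ({..<n} \<inter> ?B)) * ln 2"
    by (simp add: sum.If_cases)
  also have "\<dots> \<le> real K * ln 2"
  proof -
    have "card ({..<n} \<inter> ?B) \<le> card ?B" by (intro card_mono) auto
    also have "\<dots> \<le> K" using card_image_le[of "{1..K}" \<tau>] by simp
    finally show ?thesis by simp
  qed
  finally show ?thesis by simp
qed

end

theorem block_converse:
  assumes sig: "\<forall>k\<in>{1..K}. sig2 k > 0" and "n > 0" and L: "L > 32" and P: "P \<ge> 0"
    and g: "\<forall>k\<in>{1..K}. g k \<in> measurable (PiM {..<n} (\<lambda>_. borel)) (count_space UNIV)"
    and power: "lin_power K sig2 n L a b \<theta> \<le> ennreal P"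
    and err: "lin_error K sig2 n L a b \<theta> g < 1 / 4"
  defines "\<delta> \<equiv> 16 * real n * sqrt (4 * real n * P + 1) / real L"
  obtains \<rho> :: "nat \<Rightarrow> nat \<Rightarrow> real" where "\<And>k j. \<rho> k j \<ge> 0" "(\<Sum>j<n. \<rho> 0 j) \<le> real n * P"
    "\<And>k. k \<in> {1..K} \<Longrightarrow> ln (sig2 k / 2 / \<delta>\<^sup>2) \<le>
      (\<Sum>j<n. ln ((\<rho> (k - 1) j + N_eff sig2 k) / (\<rho> k j + N_eff sig2 k))) + real K * ln 2"
proof -
  let ?I = "{1..K} \<times> {..<n}" and ?v = "noise_var K sig2"
  interpret gaussian_noise ?I ?v by (rule gaussian_noise_noise_var[OF sig])
  obtain d c' where X': "\<And>\<theta> z i. lin_X K a b \<theta> z i = d i * \<theta> + (\<Sum>p\<in>{1..K} \<times> {..<i}. c' i p * z p)"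
    using lin_X_affine[of K a b] by blast
  \<comment> \<open>Padding with zeros lets all inputs be written over one index set, while keeping
    causality.\<close>
  define c where "c i p = (if snd p < i then c' i p else 0)" for i p
  have X: "lin_X K a b \<theta> z i = d i * \<theta> + (\<Sum>p\<in>?I. c i p * z p)" if "i < n" for \<theta> z i
  proof -
    have "(\<Sum>p\<in>?I. c i p * z p) = (\<Sum>p\<in>{1..K} \<times> {..<i}. c' i p * z p)"
      using that by (intro sum.mono_neutral_cong_right) (auto simp: c_def)
    then show ?thesis by (simp add: X')
  qed
  \<comment> \<open>The Boolean marks two orthogonal halves of each noise, of variance
    \<open>?v p / 2\<close> each; their sum \<open>e p\<close> models the full noise.\<close>
  define q where "q p \<beta> = Poly_Mapping.single (p :: nat \<times> nat, \<beta> :: bool) (sqrt (?v p / 2))" for p \<beta>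
  have qq: "q p \<beta> \<bullet> q p' \<beta>' = (if p = p' \<and> \<beta> = \<beta>' then ?v p / 2 else 0)" for p \<beta> p' \<beta>'
    using v_pos[of p] by (auto simp: q_def inner_single)
  define e where "e p = q p True + q p False" for p
  have ee: "e p \<bullet> e p' = (if p = p' then ?v p else 0)" for p p'
    by (simp add: e_def inner_add_left inner_add_right qq)
  \<comment> \<open>Only the noise part of the input is kept: the message point is dropped, and its
    role passes to the halves of noise chosen below.\<close>
  define x where "x i = (\<Sum>p\<in>?I. c i p *\<^sub>R e p)" for i
  have xx: "(norm (x i))\<^sup>2 = (\<Sum>p\<in>?I. (c i p)\<^sup>2 * ?v p)" for i
  proof -
    have "e p \<bullet> x i = c i p * ?v p" if "p \<in> ?I" for p
    proof -
      have "e p \<bullet> x i = (\<Sum>p'\<in>?I. if p' = p then c i p * ?v p else 0)"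
        unfolding x_def inner_sum_right by (intro sum.cong) (auto simp: ee)
      then show ?thesis using that by (simp add: fin)
    qed
    then have "x i \<bullet> x i = (\<Sum>p\<in>?I. c i p * (c i p * ?v p))"
      by (subst (1) x_def) (simp add: inner_sum_left)
    then show ?thesis unfolding power2_norm_eq_inner by (simp add: power2_eq_square mult.assoc)
  qed
  have pow: "(\<Sum>m\<in>{1..L}. \<Sum>i<n. (d i)\<^sup>2 * (\<theta> m)\<^sup>2 + (norm (x i))\<^sup>2) \<le> real n * real L * P"
    using lin_power_bound[OF sig assms(2) _ P X power] L by (simp add: xx)
  have powx: "(\<Sum>i<n. (norm (x i))\<^sup>2) \<le> real n * P"
  proof -
    have "real L * (\<Sum>i<n. (norm (x i))\<^sup>2) = (\<Sum>m\<in>{1..L}. \<Sum>i<n. (norm (x i))\<^sup>2)" by simp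
    also have "\<dots> \<le> real n * real L * P" by (rule order_trans[OF _ pow]) (intro sum_mono, simp)
    finally have "real L * (\<Sum>i<n. (norm (x i))\<^sup>2) \<le> real L * (real n * P)" by (simp add: mult_ac)
    then show ?thesis using L by simp
  qed
  have powd: "(d i)\<^sup>2 * (\<Sum>m\<in>{1..L}. (\<theta> m)\<^sup>2) \<le> real n * real L * P" if "i < n" for i
  proof -
    have "(d i)\<^sup>2 * (\<theta> m)\<^sup>2 \<le> (\<Sum>i<n. (d i)\<^sup>2 * (\<theta> m)\<^sup>2 + (norm (x i))\<^sup>2)" for m
    proof -
      have "(d i)\<^sup>2 * (\<theta> m)\<^sup>2 + (norm (x i))\<^sup>2 \<le> (\<Sum>i<n. (d i)\<^sup>2 * (\<theta> m)\<^sup>2 + (norm (x i))\<^sup>2)"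
        using that by (intro member_le_sum) auto
      then show ?thesis using zero_le_power2[of "norm (x i)"] by linarith
    qed
    then have "(\<Sum>m\<in>{1..L}. (d i)\<^sup>2 * (\<theta> m)\<^sup>2) \<le> real n * real L * P"
      by (intro order_trans[OF sum_mono pow])
    then show ?thesis by (simp add: sum_distrib_left)
  qed
  define r where "r k i p = c i p + (if p = (k, i) then 1 else 0)" for k i p
  have R: "(\<Sum>p\<in>?I. r k j p *\<^sub>R e p) = x j + e (k, j)" if "k \<in> {1..K}" "j < n" for k j
  proof -
    have "(\<Sum>p\<in>?I. (if p = (k, j) then 1 else 0) *\<^sub>R e p) = (\<Sum>p\<in>?I. if p = (k, j) then e p else 0)"
      by (intro sum.cong) auto
    also have "\<dots> = e (k, j)" using that by (simp add: fin)
    finally show ?thesis by (simp add: r_def x_def scaleR_left_distrib sum.distrib)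
  qed
  have "\<forall>k\<in>{1..K}. \<exists>t. fst t < n \<and> snd t (fst t) = 1 \<and> norm (\<Sum>j<n. snd t j *\<^sub>R (x j + e (k, j))) \<le> \<delta>"
  proof
    fix k assume k: "k \<in> {1..K}"
    have "3 / 4 * real L \<le> (\<Sum>m\<in>{1..L}. measure noise {z \<in> space noise.
        g k (restrict (\<lambda>i. d i * \<theta> m + (\<Sum>p\<in>?I. r k i p * z p)) {..<n}) = m})"
      using lin_error_bound[OF sig _ k X g err] L by (simp add: r_def)
    then obtain i u where "i < n" "u i = 1" "norm (\<Sum>j<n. u j *\<^sub>R (\<Sum>p\<in>?I. r k j p *\<^sub>R e p)) \<le> \<delta>"
      using receiver_combination[of e "g k" n L P d \<theta> "r k"] ee g k L P powd unfolding \<delta>_def by blast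
    then show "\<exists>t. fst t < n \<and> snd t (fst t) = 1 \<and> norm (\<Sum>j<n. snd t j *\<^sub>R (x j + e (k, j))) \<le> \<delta>"
      using R[OF k] by (intro exI[of _ "(i, u)"]) simp
  qed
  from bchoice[OF this] obtain t where t: "\<forall>k\<in>{1..K}. fst (t k) < n \<and> snd (t k) (fst (t k)) = 1 \<and>
      norm (\<Sum>j<n. snd (t k) j *\<^sub>R (x j + e (k, j))) \<le> \<delta>"
    by blast
  define \<tau> u where "\<tau> k = fst (t k)" and "u k = snd (t k)" for k
  have \<tau>: "\<And>k. k \<in> {1..K} \<Longrightarrow> \<tau> k < n" "\<And>k. k \<in> {1..K} \<Longrightarrow> u k (\<tau> k) = 1"
    and u: "\<And>k. k \<in> {1..K} \<Longrightarrow> norm (\<Sum>j<n. u k j *\<^sub>R (x j + e (k, j))) \<le> \<delta>"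
    using t by (simp_all add: \<tau>_def u_def)
  \<comment> \<open>The message of receiver \<open>k\<close> is one half of its noise at slot
    \<open>\<tau> k\<close>, where its combination has coefficient 1. What is left over is the noise
    \<open>z\<close>, so the small combination of outputs reads \<open>m k + p\<close> with
    \<open>p\<close> spanned by observations.\<close>
  define m where "m k = q (k, \<tau> k) True" for k
  define z where "z k j = (if j = \<tau> k then q (k, j) False else e (k, j))" for k j
  \<comment> \<open>Causality: the input at time \<open>i\<close> contains only noise from times
    before \<open>i\<close>.\<close>
  have zx: "z k j \<bullet> x i = 0" if "i \<le> j" for k j i
  proof -
    have "z k j \<bullet> (c i p *\<^sub>R e p) = 0" for p
      using that by (cases p) (auto simp: c_def z_def e_def inner_add_left inner_add_right qq)
    then show ?thesis by (simp add: x_def inner_sum_right del: inner_scaleR_right)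
  qed
  have zn: "(norm (z k j))\<^sup>2 = (if j = \<tau> k then sig2 k / 2 else sig2 k)" if "k \<in> {1..K}" for k j
    using that by (auto simp: z_def power2_norm_eq_inner qq ee noise_var_def)
  interpret degraded_observations K m x z
  proof
    fix k j assume k: "k \<in> {1..K}"
    then have "sig2 k > 0" using sig by blast
    then show "z k j \<noteq> 0" using zn[OF k, of j] by (auto split: if_splits)
  next
    fix k j i :: nat assume "i \<le> j"
    then show "z k j \<bullet> x i = 0" by (rule zx)
  qed (auto simp: m_def z_def e_def inner_add_left inner_add_right qq)
  have dpos: "\<delta> > 0" unfolding \<delta>_def using assms(2) L P
    by (intro divide_pos_pos mult_pos_pos) (auto intro!: add_nonneg_pos)
  show ?thesis
  proof (rule that[of residual])
    show "residual k j \<ge> 0" for k j by simp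
    show "(\<Sum>j<n. residual 0 j) \<le> real n * P"
      by (rule order_trans[OF sum_mono[OF residual_0] powx])
    fix k assume k: "k \<in> {1..K}"
    have mn: "(norm (m k))\<^sup>2 = sig2 k / 2"
      using k by (simp add: m_def power2_norm_eq_inner qq noise_var_def)
    define p where "p = (\<Sum>j<n. u k j *\<^sub>R (x j + z k j))"
    have "p \<in> span (obs k n)"
      unfolding p_def using k by (intro span_sum span_scale span_base) (auto simp: obs_def image_iff)
    moreover have "m k + p = (\<Sum>j<n. u k j *\<^sub>R (x j + e (k, j)))"
    proof -
      have "(\<Sum>j<n. u k j *\<^sub>R (x j + e (k, j))) = (\<Sum>j<n. u k j *\<^sub>R (x j + z k j) + (if j = \<tau> k then m k else 0))"
        using \<tau>(2)[OF k] by (intro sum.cong) (auto simp: z_def m_def e_def algebra_simps)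
      then show ?thesis using \<tau>(1)[OF k] by (simp add: sum.distrib p_def)
    qed
    moreover have "m k \<noteq> 0"
    proof -
      have "sig2 k > 0" using sig k by blast
      then show ?thesis using mn by auto
    qed
    ultimately have "ln ((norm (m k))\<^sup>2 / \<delta>\<^sup>2) \<le>
        (\<Sum>j<n. ln ((residual (k - 1) j + N_eff sig2 k) / (residual k j + N_eff sig2 k))) + real K * ln 2"
      using u[OF k] dpos sig zn
      by (intro converse_ln_reduced_noise[OF k, where p = p and \<tau> = \<tau>]) auto
    then show "ln (sig2 k / 2 / \<delta>\<^sup>2) \<le>
        (\<Sum>j<n. ln ((residual (k - 1) j + N_eff sig2 k) / (residual k j + N_eff sig2 k))) + real K * ln 2"
      by (simp only: mn)
  qed
qed

section \<open>The converse\<close>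

lemma N_eff_pos:
  assumes "\<forall>k\<in>{1..K}. sig2 k > 0" "k \<in> {1..K}"
  shows "N_eff sig2 k > 0"
proof -
  have "(\<Sum>k'\<in>{1..k}. inverse (sig2 k')) > 0" using assms by (intro sum_pos) auto
  then show ?thesis by (simp add: N_eff_def)
qed

lemma N_eff_Suc_le:
  assumes sig: "\<forall>k\<in>{1..K}. sig2 k > 0" and k: "k \<in> {1..<K}"
  shows "N_eff sig2 (Suc k) \<le> N_eff sig2 k"
proof -
  have "(\<Sum>k'\<in>{1..k}. inverse (sig2 k')) > 0" using assms by (intro sum_pos) auto
  moreover have "inverse (sig2 (Suc k)) > 0" using assms by auto
  ultimately show ?thesis by (simp add: N_eff_def le_imp_inverse_le)
qed

lemma num_msgs_lower: "real (num_msgs n R) \<ge> exp (real n * R) - 1"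
  unfolding num_msgs_def by (subst of_nat_nat) (simp, linarith)

text \<open>The block gains are averaged with the multipliers \<open>lam\<close>, and each time slot
  is bounded by its value at the water levels. The left side grows like \<open>2 * n * R\<close>,
  because the reconstruction error decays like \<open>exp (- n * R)\<close> up to polynomial
  factors.\<close>

lemma achievable_rate_bound:
  assumes K: "K \<ge> 1" and sig: "\<forall>k\<in>{1..K}. sig2 k > 0" and P: "P > 0"
    and p: "p 0 = P" "\<And>k. k \<le> K \<Longrightarrow> p k \<ge> 0" "p K = 0"
    and step: "\<And>k. k \<in> {1..K} \<Longrightarrow> p (k - 1) + N_eff sig2 k = \<rho> * (p k + N_eff sig2 k)"
    and ach: "lin_achievable K P sig2 R"
  shows "2 * R \<le> ln \<rho>"
proof -
  obtain lam :: "nat \<Rightarrow> real" and mu :: real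
    where lam: "\<And>k. k \<in> {1..K} \<Longrightarrow> lam k > 0" and mu: "mu \<ge> 0"
      and opt: "\<And>a. (\<And>k. k \<le> K \<Longrightarrow> a k \<ge> 0) \<Longrightarrow>
       (\<Sum>k\<in>{1..K}. lam k * ln ((a (k - 1) + N_eff sig2 k) / (a k + N_eff sig2 k)))
         \<le> (\<Sum>k\<in>{1..K}. lam k) * ln \<rho> + mu * (a 0 - p 0)"
    using sum_ln_ratio_bound[of K "N_eff sig2" p \<rho>] K N_eff_pos[OF sig] N_eff_Suc_le[OF sig] p(2,3) step
    by blast
  define S where "S = (\<Sum>k\<in>{1..K}. lam k)"
  have S: "S > 0" unfolding S_def using lam K by (intro sum_pos) auto
  \<comment> \<open>Collects the terms that do not grow with \<open>n\<close>: the loss from halved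
    noise and the message variances.\<close>
  define C where "C = real K * ln 2 - (\<Sum>k\<in>{1..K}. lam k * ln (sig2 k / 2)) / S"
  have R: "R > 0" using ach by (simp add: lin_achievable_def)
  obtain n0 where n0: "\<And>n. n \<ge> n0 \<Longrightarrow> lin_scheme_ok K P sig2 n (num_msgs n R) (1 / 4)"
    using ach unfolding lin_achievable_def by (metis divide_pos_pos zero_less_numeral zero_less_one)
  have main: "2 * R \<le> ln \<rho> + (C + 2 * ln (32 * real n * sqrt (4 * real n * P + 1))) / real n"
    if n: "n \<ge> n0" "n \<ge> 1" "real n * R \<ge> 33" for n
  proof -
    define L where "L = num_msgs n R"
    define \<delta> where "\<delta> = 16 * real n * sqrt (4 * real n * P + 1) / real L"
    \<comment> \<open>The threshold 33 makes \<open>exp (n * R) - 1\<close> exceed 32 and dominate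
      \<open>exp (n * R) / 2\<close>.\<close>
    have E: "exp (real n * R) \<ge> 34" using exp_ge_add_one_self[of "real n * R"] n(3) by linarith
    then have L: "L > 32" "real L \<ge> exp (real n * R) / 2"
      using num_msgs_lower[of n R] unfolding L_def by linarith+
    obtain \<theta> a b g where g: "\<forall>k\<in>{1..K}. g k \<in> measurable (PiM {..<n} (\<lambda>_. borel)) (count_space UNIV)"
      and pw: "lin_power K sig2 n L a b \<theta> \<le> ennreal P" and er: "lin_error K sig2 n L a b \<theta> g < 1 / 4"
      using n0[OF n(1)] unfolding lin_scheme_ok_def L_def by blast
    obtain r :: "nat \<Rightarrow> nat \<Rightarrow> real" where r: "\<And>k j. r k j \<ge> 0" "(\<Sum>j<n. r 0 j) \<le> real n * P"
      and gain: "\<And>k. k \<in> {1..K} \<Longrightarrow> ln (sig2 k / 2 / \<delta>\<^sup>2) \<le>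
        (\<Sum>j<n. ln ((r (k - 1) j + N_eff sig2 k) / (r k j + N_eff sig2 k))) + real K * ln 2"
      using block_converse[OF sig _ L(1) _ g pw er] n(2) P unfolding \<delta>_def by auto
    have sq: "sqrt (4 * real n * P + 1) > 0" using P by (auto intro!: add_nonneg_pos)
    have d: "\<delta> > 0" unfolding \<delta>_def using n(2) sq L by simp
    have "(\<Sum>k\<in>{1..K}. lam k * (ln (sig2 k / 2) - 2 * ln \<delta>)) \<le>
        (\<Sum>k\<in>{1..K}. lam k * ((\<Sum>j<n. ln ((r (k - 1) j + N_eff sig2 k) / (r k j + N_eff sig2 k))) + real K * ln 2))"
    proof (intro sum_mono mult_left_mono)
      fix k assume k: "k \<in> {1..K}"
      have "sig2 k > 0" using sig k by blast
      then have "ln (sig2 k / 2 / \<delta>\<^sup>2) = ln (sig2 k / 2) - 2 * ln \<delta>"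
        using d by (subst ln_div) (auto simp: ln_realpow)
      then show "ln (sig2 k / 2) - 2 * ln \<delta> \<le>
          (\<Sum>j<n. ln ((r (k - 1) j + N_eff sig2 k) / (r k j + N_eff sig2 k))) + real K * ln 2"
        using gain[OF k] by simp
      show "lam k \<ge> 0" using lam[OF k] by simp
    qed
    also have "\<dots> = (\<Sum>j<n. \<Sum>k\<in>{1..K}. lam k * ln ((r (k - 1) j + N_eff sig2 k) / (r k j + N_eff sig2 k))) + S * (real K * ln 2)"
      by (subst sum.swap) (simp add: S_def sum_distrib_left sum_distrib_right distrib_left sum.distrib)
    also have "\<dots> \<le> (\<Sum>j<n. S * ln \<rho> + mu * (r 0 j - P)) + S * (real K * ln 2)"
      using opt[of "\<lambda>k. r k _"] r(1) p(1) by (intro add_right_mono sum_mono) (simp add: S_def)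
    also have "(\<Sum>j<n. S * ln \<rho> + mu * (r 0 j - P)) = real n * (S * ln \<rho>) + mu * ((\<Sum>j<n. r 0 j) - real n * P)"
      by (simp add: sum.distrib sum_distrib_left[symmetric] sum_subtractf)
    \<comment> \<open>The slots may use unequal powers; only their sum enters, and the power
      constraint bounds it.\<close>
    also have "\<dots> \<le> real n * (S * ln \<rho>)" using mu r(2) by (simp add: mult_nonneg_nonpos)
    finally have "(\<Sum>k\<in>{1..K}. lam k * ln (sig2 k / 2)) - S * (2 * ln \<delta>) \<le> real n * (S * ln \<rho>) + S * (real K * ln 2)"
      by (simp add: S_def right_diff_distrib sum_subtractf sum_distrib_right)
    moreover have "(\<Sum>k\<in>{1..K}. lam k * ln (sig2 k / 2)) = S * (real K * ln 2 - C)"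
      using S by (simp add: C_def)
    ultimately have "S * (- 2 * ln \<delta>) \<le> S * (real n * ln \<rho> + C)" by (simp add: algebra_simps)
    then have 1: "- 2 * ln \<delta> \<le> real n * ln \<rho> + C" using S by (rule mult_left_le_imp_le)
    define w where "w = 32 * real n * sqrt (4 * real n * P + 1)"
    have w: "w > 0" unfolding w_def using n(2) sq by simp
    have "\<delta> = (w / 2) / real L" by (simp add: \<delta>_def w_def)
    also have "\<dots> \<le> (w / 2) / (exp (real n * R) / 2)" using L(2) w by (intro divide_left_mono) (auto intro!: mult_pos_pos less_le_trans[OF _ L(2)])
    finally have "\<delta> \<le> w / exp (real n * R)" by simp
    then have "ln \<delta> \<le> ln (w / exp (real n * R))" using d by (intro ln_mono) (auto simp: w)
    also have "\<dots> = ln w - real n * R" using w by (simp add: ln_div)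
    finally have "2 * (real n * R) \<le> real n * ln \<rho> + (C + 2 * ln w)" using 1 by simp
    then have "(2 * R - ln \<rho>) * real n \<le> C + 2 * ln w" by (simp add: algebra_simps)
    then have "2 * R - ln \<rho> \<le> (C + 2 * ln w) / real n"
      using n(2) by (subst pos_le_divide_eq) auto
    then show ?thesis unfolding w_def by linarith
  qed
  have ev: "eventually (\<lambda>n. n \<ge> n0 \<and> n \<ge> 1 \<and> real n * R \<ge> 33) sequentially"
  proof -
    have "filterlim (\<lambda>n. real n * R) at_top sequentially" using R by real_asymp
    then have "eventually (\<lambda>n. real n * R \<ge> 33) sequentially" by (simp add: filterlim_at_top)
    then show ?thesis using eventually_ge_at_top[of n0] eventually_ge_at_top[of 1]
      by eventually_elim simp
  qed
  have "(\<lambda>n. (C + 2 * ln (32 * real n * sqrt (4 * real n * P + 1))) / real n) \<longlonglongrightarrow> 0"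
    using P by real_asymp
  then have "(\<lambda>n. ln \<rho> + (C + 2 * ln (32 * real n * sqrt (4 * real n * P + 1))) / real n) \<longlonglongrightarrow> ln \<rho> + 0"
    by (intro tendsto_add tendsto_const)
  then have "2 * R \<le> ln \<rho> + 0"
    by (rule tendsto_lowerbound) (use ev main in \<open>auto elim: eventually_mono\<close>)
  then show ?thesis by simp
qed

text \<open>The shares \<open>\<alpha> k\<close> and the levels
  \<open>p k = (1 - \<alpha> 1 - ... - \<alpha> k) * P\<close> determine each other, and equal rates
  mean a common ratio \<open>\<rho>\<close>. Existence comes from the shooting argument; the bound
  applies to every admissible choice of shares.\<close>

theorem theorem1:
  fixes K :: nat and P :: real and sig2 :: "nat \<Rightarrow> real"
  assumes "K \<ge> 2" and "P > 0"
    and "\<forall>k\<in>{1..K}. sig2 k > 0"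
    and "\<forall>k\<in>{1..<K}. sig2 (Suc k) \<le> sig2 k"
  shows "(\<exists>\<alpha>::nat \<Rightarrow> real.
            (\<forall>k\<in>{1..K}. 0 < \<alpha> k \<and> \<alpha> k < 1) \<and> (\<Sum>k\<in>{1..K}. \<alpha> k) = 1 \<and>
            (\<forall>k\<in>{2..K}.
               (1/2) * ln (1 + \<alpha> k * P / ((1 - (\<Sum>k'\<in>{1..k}. \<alpha> k')) * P + N_eff sig2 k))
               = (1/2) * ln (1 + \<alpha> 1 * P / ((1 - \<alpha> 1) * P + sig2 1)))) \<and>
         (\<forall>\<alpha>::nat \<Rightarrow> real.
            (\<forall>k\<in>{1..K}. 0 < \<alpha> k \<and> \<alpha> k < 1) \<and> (\<Sum>k\<in>{1..K}. \<alpha> k) = 1 \<and>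
            (\<forall>k\<in>{2..K}.
               (1/2) * ln (1 + \<alpha> k * P / ((1 - (\<Sum>k'\<in>{1..k}. \<alpha> k')) * P + N_eff sig2 k))
               = (1/2) * ln (1 + \<alpha> 1 * P / ((1 - \<alpha> 1) * P + sig2 1)))
            \<longrightarrow> lin_capacity K P sig2 \<le> ereal ((1/2) * ln (1 + \<alpha> 1 * P / ((1 - \<alpha> 1) * P + sig2 1))))"
    (is "Ex ?Q \<and> (\<forall>\<alpha>. ?Q \<alpha> \<longrightarrow> ?B \<alpha>)")
proof (intro conjI allI impI)
  note N = N_eff_pos[OF assms(3)]
  have N1: "N_eff sig2 1 = sig2 1" by (simp add: N_eff_def)
  obtain \<rho> p where \<rho>: "\<rho> > 1" and p: "p 0 = P" "p K = 0"
    and step: "\<And>k. k \<in> {1..K} \<Longrightarrow> p (k - 1) + N_eff sig2 k = \<rho> * (p k + N_eff sig2 k)"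
    using exists_power_levels[of K "N_eff sig2" P] N assms(1,2) by (metis One_nat_def Suc_1 Suc_leD)
  have nonneg: "p k \<ge> 0" if "k \<le> K" for k
    using power_levels_nonneg[of K "N_eff sig2" \<rho> p k] N step \<rho> p that by auto
  have decr: "p k < p (k - 1)" if "k \<in> {1..K}" for k
    using power_levels_decreasing[of K "N_eff sig2" \<rho> p k] N step \<rho> p that by auto
  define \<alpha> where "\<alpha> k = (p (k - 1) - p k) / P" for k
  have sum_\<alpha>: "(\<Sum>k'\<in>{1..k}. \<alpha> k') = (P - p k) / P" for k
  proof (induction k)
    case (Suc k)
    then show ?case by (simp add: \<alpha>_def diff_divide_distrib)
  qed (simp add: p)
  have pos: "\<alpha> k > 0" if "k \<in> {1..K}" for k using decr[OF that] assms(2) by (simp add: \<alpha>_def)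
  have total: "(\<Sum>k\<in>{1..K}. \<alpha> k) = 1" using sum_\<alpha>[of K] p assms(2) by simp
  have lt1: "\<alpha> k < 1" if k: "k \<in> {1..K}" for k
  proof -
    have "(\<Sum>k'\<in>{1..K}. \<alpha> k') = \<alpha> k + (\<Sum>k'\<in>{1..K} - {k}. \<alpha> k')"
      using k by (intro sum.remove) auto
    moreover have "(\<Sum>k'\<in>{1..K} - {k}. \<alpha> k') > 0"
    proof (rule sum_pos)
      \<comment> \<open>As \<open>K \<ge> 2\<close>, some other share is positive, which keeps
        \<open>\<alpha> k\<close> strictly below 1.\<close>
      have "(if k = 1 then 2 else 1) \<in> {1..K} - {k}" using assms(1) k by auto
      then show "{1..K} - {k} \<noteq> {}" by blast
    qed (use pos in auto)
    ultimately show ?thesis using total by simp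
  qed
  have ratio: "1 + \<alpha> k * P / ((1 - (\<Sum>k'\<in>{1..k}. \<alpha> k')) * P + N_eff sig2 k) = \<rho>" if k: "k \<in> {1..K}" for k
  proof -
    have "p k + N_eff sig2 k > 0" using nonneg[of k] N[OF k] k by (intro add_nonneg_pos) auto
    moreover have e1: "(1 - (\<Sum>k'\<in>{1..k}. \<alpha> k')) * P = p k"
      unfolding sum_\<alpha> using assms(2) by (simp add: field_simps)
    moreover have e2: "\<alpha> k * P = p (k - 1) - p k" using assms(2) by (simp add: \<alpha>_def)
    ultimately show ?thesis unfolding e1 e2 using step[OF k] by (simp add: field_simps)
  qed
  have r1: "1 + \<alpha> 1 * P / ((1 - \<alpha> 1) * P + sig2 1) = \<rho>"
    using ratio[of 1] assms(1) N1 by simp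
  have "?Q \<alpha>"
  proof (intro conjI ballI)
    show "(\<Sum>k\<in>{1..K}. \<alpha> k) = 1" by (rule total)
    fix k assume "k \<in> {1..K}"
    then show "0 < \<alpha> k" "\<alpha> k < 1" by (rule pos, rule lt1)
  next
    fix k assume "k \<in> {2..K}"
    then have "k \<in> {1..K}" by simp
    then show "(1/2) * ln (1 + \<alpha> k * P / ((1 - (\<Sum>k'\<in>{1..k}. \<alpha> k')) * P + N_eff sig2 k))
        = (1/2) * ln (1 + \<alpha> 1 * P / ((1 - \<alpha> 1) * P + sig2 1))"
      by (simp only: ratio r1)
  qed
  then show "Ex ?Q" by (rule exI[of ?Q \<alpha>])
next
  fix \<alpha> :: "nat \<Rightarrow> real"
  assume Q: "?Q \<alpha>"
  from Q have pos: "\<And>k. k \<in> {1..K} \<Longrightarrow> 0 < \<alpha> k" by blast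
  from Q have total: "(\<Sum>k\<in>{1..K}. \<alpha> k) = 1" by blast
  from Q have eq: "\<And>k. k \<in> {2..K} \<Longrightarrow>
      (1/2) * ln (1 + \<alpha> k * P / ((1 - (\<Sum>k'\<in>{1..k}. \<alpha> k')) * P + N_eff sig2 k))
      = (1/2) * ln (1 + \<alpha> 1 * P / ((1 - \<alpha> 1) * P + sig2 1))" by blast
  note N = N_eff_pos[OF assms(3)]
  define \<rho> where "\<rho> = 1 + \<alpha> 1 * P / ((1 - \<alpha> 1) * P + sig2 1)"
  define p where "p k = (1 - (\<Sum>k'\<in>{1..k}. \<alpha> k')) * P" for k
  have nonneg: "p k \<ge> 0" if "k \<le> K" for k
  proof -
    have "(\<Sum>k'\<in>{1..k}. \<alpha> k') \<le> (\<Sum>k'\<in>{1..K}. \<alpha> k')"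
      using that pos by (intro sum_mono2) (auto simp: less_imp_le)
    then show ?thesis unfolding total using assms(2) by (simp add: p_def)
  qed
  have ratio: "1 + \<alpha> k * P / (p k + N_eff sig2 k) = \<rho>" if k: "k \<in> {1..K}" for k
  proof (cases "k = 1")
    case True
    then show ?thesis by (simp add: \<rho>_def p_def N_eff_def)
  next
    case False
    then have k2: "k \<in> {2..K}" using k by auto
    \<comment> \<open>Positivity of both arguments allows the logarithms to be cancelled.\<close>
    have gt: "1 + \<alpha> l * P / (p l + N_eff sig2 l) > 0" if l: "l \<in> {1..K}" for l
    proof -
      have "p l + N_eff sig2 l > 0" using nonneg[of l] N[OF l] l by (intro add_nonneg_pos) auto
      moreover have "\<alpha> l * P > 0" using pos[OF l] assms(2) by simp
      ultimately show ?thesis by (intro add_pos_pos) auto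
    qed
    have "\<rho> > 0" using gt[of 1] assms(1) by (simp add: \<rho>_def p_def N_eff_def)
    moreover have "ln (1 + \<alpha> k * P / (p k + N_eff sig2 k)) = ln \<rho>"
      using eq[OF k2] unfolding \<rho>_def p_def by simp
    ultimately show ?thesis using gt[OF k] by simp
  qed
  have step: "p (k - 1) + N_eff sig2 k = \<rho> * (p k + N_eff sig2 k)" if k: "k \<in> {1..K}" for k
  proof -
    have "p k + N_eff sig2 k > 0" using nonneg[of k] N[OF k] k by (intro add_nonneg_pos) auto
    moreover have "p (k - 1) = p k + \<alpha> k * P"
    proof -
      have "(\<Sum>k'\<in>{1..k}. \<alpha> k') = (\<Sum>k'\<in>{1..k - 1}. \<alpha> k') + \<alpha> k" using k by (cases k) auto
      then show ?thesis by (simp add: p_def algebra_simps)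
    qed
    ultimately show ?thesis using ratio[OF k] by (simp add: field_simps)
  qed
  have "R \<le> (1/2) * ln \<rho>" if "lin_achievable K P sig2 R" for R
    using achievable_rate_bound[of K sig2 P p \<rho> R] assms(1-3) nonneg step that total by (simp add: p_def)
  then show "?B \<alpha>" unfolding lin_capacity_def \<rho>_def by (intro Sup_least) auto
qed

end
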